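(* There exist no PNMC biharmonic $3$-type submanifolds $M^m$ in the unit Euclidean sphere $\mathbb{S}^n$.
   Context: All manifolds are smooth and connected; submanifolds are not assumed compact. Let $\varphi:M^m\to N$ be the inclusion of an $m$-dimensional submanifold in a Riemannian manifold $N$, with mean curvature vector field $H$ (so $mH$ is the trace of the second fundamental form) and mean curvature $f=|H|$. $M$ is biharmonic if $\Delta H+\operatorname{trace}R^N(d\varphi(\cdot),H)d\varphi(\cdot)=0$, where $\Delta V=-\operatorname{trace}\nabla^2V$ is the rough Laplacian on sections of $\varphi^{-1}(TN)$ and $R^N(X,Y)=[\nabla_X,\nabla_Y]-\nabla_{[X,Y]}$. $M$ is PNMC if $f>0$ everywhere and $\nabla^\perp(H/f)=0$, where $\nabla^\perp$ is the normal connection. (Here $N=\mathbb{S}^n$.) Finite type: a submanifold $M\subset\mathbb{R}^{n+1}$ with inclusion $\phi$ is of $k$-type if $\phi=\phi_0+\phi_{t_1}+\dots+\phi_{t_k}$, where $\phi_0\in\mathbb{R}^{n+1}$ is a constant vector, the $\phi_{t_i}:M\to\mathbb{R}^{n+1}$ are non-constant maps with $\Delta\phi_{t_i}=\lambda_{t_i}\phi_{t_i}$ ($\Delta=-\operatorname{trace}\nabla d$ the Laplacian of $M$, acting componentwise), and the real numbers $\lambda_{t_1},\dots,\lambda_{t_k}$ are mutually distinct. A submanifold of $\mathbb{S}^n$ is of $k$-type if it is so as a submanifold of $\mathbb{R}^{n+1}$ via the canonical inclusion $\mathbb{S}^n\subset\mathbb{R}^{n+1}$. *)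

theory Defs
  imports "HOL-Analysis.Analysis"
begin

section \<open>Smooth maps on open subsets of Euclidean spaces\<close>

primrec Ck_on :: "nat \<Rightarrow> 'a::euclidean_space set \<Rightarrow> ('a \<Rightarrow> 'b::real_normed_vector) \<Rightarrow> bool" where
  "Ck_on 0 S f \<longleftrightarrow> continuous_on S f"
| "Ck_on (Suc k) S f \<longleftrightarrow> (\<forall>x\<in>S. f differentiable (at x)) \<and>
     (\<forall>v. Ck_on k S (\<lambda>x. frechet_derivative f (at x) v))"

definition smooth_on :: "'a::euclidean_space set \<Rightarrow> ('a \<Rightarrow> 'b::real_normed_vector) \<Rightarrow> bool" where
  "smooth_on S f \<longleftrightarrow> (\<forall>k. Ck_on k S f)"


section \<open>Submanifolds of Euclidean space\<close>

text \<open>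
  A submanifold is given by its underlying set together with its manifold topology, i.e. by a value
  \<open>M :: 'a topology\<close> whose points lie in the Euclidean space \<open>'a\<close>. Since the manifold topology may
  be strictly finer than the subspace topology, \<open>M\<close> is an immersed submanifold in general; embedded
  submanifolds are those with \<open>M = top_of_set (topspace M)\<close>. The smooth structure is the one for
  which the inclusion into \<open>'a\<close> is an immersion; its charts are the inverses of the following local
  parametrizations. The dimension is \<open>CARD('m)\<close>; dimension 0 is not covered, but there the mean
  curvature is the empty trace 0, so it is never positive.
\<close>

definition local_param ::
    "'a::euclidean_space topology \<Rightarrow> (real^'m::finite) set \<Rightarrow> (real^'m \<Rightarrow> 'a) \<Rightarrow> bool" where
  "local_param M V x \<longleftrightarrow>
     open V \<and> smooth_on V x \<and> (\<forall>u\<in>V. inj (frechet_derivative x (at u))) \<and>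
     openin M (x ` V) \<and> homeomorphic_map (top_of_set V) (subtopology M (x ` V)) x"

definition submanifold :: "'m::finite itself \<Rightarrow> 'a::euclidean_space topology \<Rightarrow> bool" where
  "submanifold _ M \<longleftrightarrow>
     Hausdorff_space M \<and> second_countable M \<and> connected_space M \<and>
     (\<forall>p\<in>topspace M. \<exists>(V :: (real^'m) set) x. local_param M V x \<and> p \<in> x ` V)"

definition smooth_map_on ::
    "'m::finite itself \<Rightarrow> 'a::euclidean_space topology \<Rightarrow> ('a \<Rightarrow> 'b::real_normed_vector) \<Rightarrow> bool" where
  "smooth_map_on _ M F \<longleftrightarrow> (\<forall>(V :: (real^'m) set) x. local_param M V x \<longrightarrow> smooth_on V (F \<circ> x))"

definition curve_at :: "'a::euclidean_space topology \<Rightarrow> 'a \<Rightarrow> 'a \<Rightarrow> (real \<Rightarrow> 'a) \<Rightarrow> bool" where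
  "curve_at M p v \<gamma> \<longleftrightarrow>
     \<gamma> 0 = p \<and> (\<exists>e>0. continuous_map (top_of_set {-e<..<e}) M \<gamma>) \<and>
     (\<gamma> has_vector_derivative v) (at 0)"

definition tangent_space :: "'a::euclidean_space topology \<Rightarrow> 'a \<Rightarrow> 'a set" where
  "tangent_space M p = {v. \<exists>\<gamma>. curve_at M p v \<gamma>}"

text \<open>
  The differential of \<open>F\<close> at \<open>p\<close> applied to \<open>v\<close>. Only meaningful for \<open>F\<close> differentiable on \<open>M\<close> and
  \<open>v \<in> tangent_space M p\<close>; all uses below are of this kind.
\<close>

definition dir_deriv ::
    "'a::euclidean_space topology \<Rightarrow> ('a \<Rightarrow> 'b::real_normed_vector) \<Rightarrow> 'a \<Rightarrow> 'a \<Rightarrow> 'b" where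
  "dir_deriv M F p v =
     (THE d. \<forall>\<gamma>. curve_at M p v \<gamma> \<longrightarrow> ((\<lambda>t. F (\<gamma> t)) has_vector_derivative d) (at 0))"


section \<open>Linear algebra in tangent spaces\<close>

definition orth_proj :: "'a::euclidean_space set \<Rightarrow> 'a \<Rightarrow> 'a" where
  "orth_proj S v = (THE w. w \<in> S \<and> (\<forall>u\<in>S. (v - w) \<bullet> u = 0))"

definition orthonormal_basis_of :: "'a::euclidean_space set \<Rightarrow> 'a set \<Rightarrow> bool" where
  "orthonormal_basis_of S E \<longleftrightarrow>
     E \<subseteq> S \<and> pairwise orthogonal E \<and> (\<forall>e\<in>E. norm e = 1) \<and> span E = S"

definition trace_over ::
    "'a::euclidean_space set \<Rightarrow> ('a \<Rightarrow> 'a \<Rightarrow> 'b::real_vector) \<Rightarrow> 'b" where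
  "trace_over S B = (\<Sum>e\<in>(SOME E. orthonormal_basis_of S E). B e e)"


section \<open>Connections, second fundamental form and curvature\<close>

text \<open>
  In this section \<open>M\<close> is a submanifold of \<open>N\<close>, itself a submanifold of the Euclidean space \<open>'a\<close>, and
  both carry the induced metrics. The first definition is the connection on the pullback of \<open>TN\<close> to
  \<open>M\<close> induced by the Levi-Civita connection of \<open>N\<close>: the component tangent to \<open>N\<close> of the flat
  derivative. For \<open>N = M\<close> it is the Levi-Civita connection of \<open>M\<close> itself.
\<close>

definition cov_deriv ::
    "'a::euclidean_space topology \<Rightarrow> 'a topology \<Rightarrow> ('a \<Rightarrow> 'a) \<Rightarrow> 'a \<Rightarrow> 'a \<Rightarrow> 'a" where
  "cov_deriv N M V p v = orth_proj (tangent_space N p) (dir_deriv M V p v)"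

text \<open>
  Tensors are evaluated on tangent vectors by extending these to smooth tangent vector fields; the
  value does not depend on the extension, and we use the tangential part of the constant field.
\<close>

definition tan_ext :: "'a::euclidean_space topology \<Rightarrow> 'a \<Rightarrow> 'a \<Rightarrow> 'a" where
  "tan_ext M w q = orth_proj (tangent_space M q) w"

definition second_fund_form ::
    "'a::euclidean_space topology \<Rightarrow> 'a topology \<Rightarrow> 'a \<Rightarrow> 'a \<Rightarrow> 'a \<Rightarrow> 'a" where
  "second_fund_form N M p v w =
     cov_deriv N M (tan_ext M w) p v - cov_deriv M M (tan_ext M w) p v"

definition mean_curv_vec :: "'a::euclidean_space topology \<Rightarrow> 'a topology \<Rightarrow> 'a \<Rightarrow> 'a" where
  "mean_curv_vec N M p =
     (1 / real (dim (tangent_space M p))) *\<^sub>R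
       trace_over (tangent_space M p) (second_fund_form N M p)"

definition mean_curv :: "'a::euclidean_space topology \<Rightarrow> 'a topology \<Rightarrow> 'a \<Rightarrow> real" where
  "mean_curv N M p = norm (mean_curv_vec N M p)"

definition normal_space :: "'a::euclidean_space topology \<Rightarrow> 'a topology \<Rightarrow> 'a \<Rightarrow> 'a set" where
  "normal_space N M p = {\<xi> \<in> tangent_space N p. \<forall>v\<in>tangent_space M p. \<xi> \<bullet> v = 0}"

definition normal_deriv ::
    "'a::euclidean_space topology \<Rightarrow> 'a topology \<Rightarrow> ('a \<Rightarrow> 'a) \<Rightarrow> 'a \<Rightarrow> 'a \<Rightarrow> 'a" where
  "normal_deriv N M \<xi> p v = orth_proj (normal_space N M p) (cov_deriv N M \<xi> p v)"

definition lie_bracket ::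
    "'a::euclidean_space topology \<Rightarrow> ('a \<Rightarrow> 'a) \<Rightarrow> ('a \<Rightarrow> 'a) \<Rightarrow> 'a \<Rightarrow> 'a" where
  "lie_bracket N X Y p = dir_deriv N Y p (X p) - dir_deriv N X p (Y p)"

text \<open>\<open>[\<nabla>\<^sub>X, \<nabla>\<^sub>Y] Z - \<nabla>\<^bsub>[X,Y]\<^esub> Z\<close> for vector fields on \<open>N\<close>, and the resulting tensor.\<close>

definition curv_field ::
    "'a::euclidean_space topology \<Rightarrow> ('a \<Rightarrow> 'a) \<Rightarrow> ('a \<Rightarrow> 'a) \<Rightarrow> ('a \<Rightarrow> 'a) \<Rightarrow> 'a \<Rightarrow> 'a" where
  "curv_field N X Y Z p =
     cov_deriv N N (\<lambda>q. cov_deriv N N Z q (Y q)) p (X p)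
     - cov_deriv N N (\<lambda>q. cov_deriv N N Z q (X q)) p (Y p)
     - cov_deriv N N Z p (lie_bracket N X Y p)"

definition riemann_curv :: "'a::euclidean_space topology \<Rightarrow> 'a \<Rightarrow> 'a \<Rightarrow> 'a \<Rightarrow> 'a \<Rightarrow> 'a" where
  "riemann_curv N p x y z = curv_field N (tan_ext N x) (tan_ext N y) (tan_ext N z) p"


section \<open>Laplacians\<close>

definition second_cov_deriv ::
    "'a::euclidean_space topology \<Rightarrow> 'a topology \<Rightarrow> ('a \<Rightarrow> 'a) \<Rightarrow> 'a \<Rightarrow> 'a \<Rightarrow> 'a \<Rightarrow> 'a" where
  "second_cov_deriv N M V p v w =
     cov_deriv N M (\<lambda>q. cov_deriv N M V q (tan_ext M w q)) p v
     - cov_deriv N M V p (cov_deriv M M (tan_ext M w) p v)"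

definition rough_laplacian ::
    "'a::euclidean_space topology \<Rightarrow> 'a topology \<Rightarrow> ('a \<Rightarrow> 'a) \<Rightarrow> 'a \<Rightarrow> 'a" where
  "rough_laplacian N M V p = - trace_over (tangent_space M p) (second_cov_deriv N M V p)"

text \<open>Hessian and Laplacian of functions on \<open>M\<close>; on vector-valued functions they act componentwise.\<close>

definition hessian ::
    "'a::euclidean_space topology \<Rightarrow> ('a \<Rightarrow> 'b::real_normed_vector) \<Rightarrow> 'a \<Rightarrow> 'a \<Rightarrow> 'a \<Rightarrow> 'b" where
  "hessian M F p v w =
     dir_deriv M (\<lambda>q. dir_deriv M F q (tan_ext M w q)) p v
     - dir_deriv M F p (cov_deriv M M (tan_ext M w) p v)"

definition laplacian ::
    "'a::euclidean_space topology \<Rightarrow> ('a \<Rightarrow> 'b::real_normed_vector) \<Rightarrow> 'a \<Rightarrow> 'b" where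
  "laplacian M F p = - trace_over (tangent_space M p) (hessian M F p)"


section \<open>Biharmonic, PNMC and finite type submanifolds\<close>

definition biharmonic :: "'a::euclidean_space topology \<Rightarrow> 'a topology \<Rightarrow> bool" where
  "biharmonic N M \<longleftrightarrow>
     (\<forall>p\<in>topspace M.
        rough_laplacian N M (mean_curv_vec N M) p
        + trace_over (tangent_space M p) (\<lambda>v w. riemann_curv N p v (mean_curv_vec N M p) w) = 0)"

definition PNMC :: "'a::euclidean_space topology \<Rightarrow> 'a topology \<Rightarrow> bool" where
  "PNMC N M \<longleftrightarrow>
     (\<forall>p\<in>topspace M. mean_curv N M p > 0) \<and>
     (\<forall>p\<in>topspace M. \<forall>v\<in>tangent_space M p.
        normal_deriv N M (\<lambda>q. (1 / mean_curv N M q) *\<^sub>R mean_curv_vec N M q) p v = 0)"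

definition finite_type ::
    "'m::finite itself \<Rightarrow> nat \<Rightarrow> 'a::euclidean_space topology \<Rightarrow> bool" where
  "finite_type T k M \<longleftrightarrow>
     (\<exists>(c::'a) (\<phi> :: nat \<Rightarrow> 'a \<Rightarrow> 'a) (\<mu> :: nat \<Rightarrow> real).
        (\<forall>p\<in>topspace M. p = c + (\<Sum>i<k. \<phi> i p)) \<and>
        (\<forall>i<k. smooth_map_on T M (\<phi> i) \<and> \<not> (\<phi> i) constant_on (topspace M) \<and>
               (\<forall>p\<in>topspace M. laplacian M (\<phi> i) p = \<mu> i *\<^sub>R \<phi> i p)) \<and>
        inj_on \<mu> {..<k})"

text \<open>The unit sphere of \<open>'a\<close>, of dimension \<open>DIM('a) - 1\<close>.\<close>

abbreviation unit_sphere :: "'a::euclidean_space topology" where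
  "unit_sphere \<equiv> top_of_set (sphere 0 1)"

end

theory Submission
  imports Defs
begin

text \<open>
  Write \<open>P\<^sub>q\<close> for the orthogonal projection onto \<open>T\<^sub>qM\<close> and \<open>\<delta>\<^sub>w F (q) = dF\<^sub>q(P\<^sub>q w)\<close> for vectors \<open>w\<close> of the
  ambient space. Then \<open>-\<Delta> = L = \<Sum>\<^sub>b \<delta>\<^sub>b \<delta>\<^sub>b\<close> over the standard basis, and all traces become such sums; no
  coordinates and no commutators are needed. For the inclusion \<open>\<phi>\<close> one gets \<open>L\<phi> = m(H - \<phi>)\<close>, and biharmonicity
  says \<open>LH = -mH + ms\<phi>\<close> with \<open>s = |H|\<^sup>2\<close>. Hence \<open>L\<^sup>2\<phi>\<close> and \<open>L\<^sup>3\<phi>\<close> are explicit combinations of \<open>\<phi>\<close>, \<open>H\<close> and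
  \<open>grad s\<close>.

  If \<open>\<phi> = c + \<phi>\<^sub>0 + \<phi>\<^sub>1 + \<phi>\<^sub>2\<close> with \<open>L\<phi>\<^sub>i = \<nu>\<^sub>i\<phi>\<^sub>i\<close>, the cubic with roots \<open>\<nu>\<^sub>i\<close> expresses the constant vector
  \<open>C = \<nu>\<^sub>0\<nu>\<^sub>1\<nu>\<^sub>2 c\<close> through \<open>\<phi>\<close>, \<open>H\<close>, \<open>grad s\<close> and \<open>Ls\<close>. For \<open>u = \<langle>C, \<phi>\<rangle>\<close> this gives \<open>\<delta>\<^sub>w u = -2m\<^sup>2 \<delta>\<^sub>w s\<close>, thus
  \<open>Lu = -2m\<^sup>2 Ls\<close>, while also \<open>Lu = \<langle>C, L\<phi>\<rangle>\<close>. Eliminating \<open>Ls\<close> makes \<open>(m + 2)u\<close> a quadratic polynomial in \<open>s\<close>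
  with leading coefficient \<open>-m\<^sup>4\<close>; differentiating, \<open>(h - 2m\<^sup>4 s) \<delta>\<^sub>w s = 0\<close> for some constant \<open>h\<close>, and so
  \<open>\<delta>\<^sub>w s = 0\<close>. For constant \<open>s\<close>, however, \<open>L\<^sup>2\<phi> + 2mL\<phi> = m\<^sup>2(s - 1)\<phi>\<close> leaves room for only two distinct
  eigenvalues.
\<close>

section \<open>Orthogonal projections and traces\<close>

text \<open>Existence comes from the orthogonal decomposition of \<open>v\<close>. Uniqueness holds
  because the difference of two candidates lies in \<open>S\<close> and is orthogonal to itself.
  Together they make the definite description in \<open>orth_proj\<close> denote.\<close>

lemma
  assumes "subspace S"
  shows orth_proj_in: "orth_proj S v \<in> S"
    and orth_proj_orth: "u \<in> S \<Longrightarrow> (v - orth_proj S v) \<bullet> u = 0"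
    and orth_proj_eqI: "w \<in> S \<Longrightarrow> (\<And>u. u \<in> S \<Longrightarrow> (v - w) \<bullet> u = 0) \<Longrightarrow> orth_proj S v = w"
proof -
  have uniq: "w = w'" if "w \<in> S" "w' \<in> S" "\<forall>u\<in>S. (v - w) \<bullet> u = 0" "\<forall>u\<in>S. (v - w') \<bullet> u = 0" for w w'
  proof -
    have "w - w' \<in> S"
      using that assms by (simp add: subspace_diff)
    with that have "(v - w') \<bullet> (w - w') - (v - w) \<bullet> (w - w') = 0"
      by simp
    then have "(w - w') \<bullet> (w - w') = 0"
      by (simp add: algebra_simps)
    then show ?thesis by simp
  qed
  obtain y z where "y \<in> span S" "\<And>w. w \<in> span S \<Longrightarrow> orthogonal z w" "v = y + z"
    by (rule orthogonal_subspace_decomp_exists[of S v]) blast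
  then have "y \<in> S \<and> (\<forall>u\<in>S. (v - y) \<bullet> u = 0)"
    using assms by (simp add: span_eq_iff[THEN iffD2] orthogonal_def)
  then have ex: "\<exists>!w. w \<in> S \<and> (\<forall>u\<in>S. (v - w) \<bullet> u = 0)"
    using uniq by blast
  from theI'[OF ex] show "orth_proj S v \<in> S" "u \<in> S \<Longrightarrow> (v - orth_proj S v) \<bullet> u = 0"
    unfolding orth_proj_def by auto
  show "orth_proj S v = w" if "w \<in> S" "\<And>u. u \<in> S \<Longrightarrow> (v - w) \<bullet> u = 0"
    unfolding orth_proj_def using ex that by (intro the1_equality) auto
qed

lemma orth_proj_self: "subspace S \<Longrightarrow> v \<in> S \<Longrightarrow> orth_proj S v = v"
  by (rule orth_proj_eqI) auto

lemma orth_proj_inner: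
  assumes "subspace S" "u \<in> S"
  shows "orth_proj S v \<bullet> u = v \<bullet> u"
  using orth_proj_orth[OF assms, of v] by (simp add: inner_diff_left)

lemma linear_orth_proj:
  assumes "subspace S"
  shows "linear (orth_proj S)"
proof (rule linearI)
  show "orth_proj S (v + w) = orth_proj S v + orth_proj S w" for v w
    by (rule orth_proj_eqI[OF assms])
      (auto simp: assms subspace_add orth_proj_in inner_diff_left inner_add_left orth_proj_inner)
  show "orth_proj S (c *\<^sub>R v) = c *\<^sub>R orth_proj S v" for c v
    by (rule orth_proj_eqI[OF assms])
      (auto simp: assms subspace_scale orth_proj_in inner_diff_left orth_proj_inner)
qed

lemma some_orthonormal_basis_of:
  assumes "subspace S"
  shows "orthonormal_basis_of S (SOME E. orthonormal_basis_of S E)"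
proof (rule orthonormal_basis_subspace[OF assms], rule someI)
  fix B :: "'a set"
  assume "B \<subseteq> S" "pairwise orthogonal B" "\<And>x. x \<in> B \<Longrightarrow> norm x = 1" "span B = S"
  then show "orthonormal_basis_of S B"
    by (simp add: orthonormal_basis_of_def)
qed

text \<open>Expanding the projection of \<open>b\<close> in the chosen basis \<open>E\<close> and
  exchanging the sums contracts \<open>\<Sum>\<^sub>b (e \<bullet> b) b\<close> to \<open>e\<close>,
  which frees the trace from the choice of \<open>E\<close>. Since \<open>B\<close> may behave well
  on \<open>S\<close> only, a representative \<open>B'\<close> that is bilinear on the whole ambient
  space takes its place.\<close>

lemma trace_over_eq:
  fixes B B' :: "'a::euclidean_space \<Rightarrow> 'a \<Rightarrow> 'b::real_vector"
  assumes S: "subspace S" and "\<And>v w. v \<in> S \<Longrightarrow> w \<in> S \<Longrightarrow> B v w = B' v w"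
    and l1: "\<And>w. linear (\<lambda>v. B' v w)" and l2: "\<And>v. linear (B' v)"
  shows "trace_over S B = (\<Sum>b\<in>Basis. B' (orth_proj S b) b)"
proof -
  define E where "E = (SOME E. orthonormal_basis_of S E)"
  have E: "orthonormal_basis_of S E"
    unfolding E_def by (rule some_orthonormal_basis_of[OF S])
  then have "E \<subseteq> S" and orth: "pairwise orthogonal E" and n: "\<And>e. e \<in> E \<Longrightarrow> norm e = 1" and sp: "span E = S"
    by (auto simp: orthonormal_basis_of_def)
  have "independent E"
    using n[of 0] by (intro pairwise_orthogonal_independent orth) auto
  then have fin: "finite E"
    by (rule independent_imp_finite)
  have P: "orth_proj S b = (\<Sum>e\<in>E. (b \<bullet> e) *\<^sub>R e)" for b
  proof -
    have "(\<Sum>e\<in>E. (orth_proj S b \<bullet> e) *\<^sub>R e) = orth_proj S b"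
      using orth_proj_in[OF S] by (intro orthonormal_basis_expand orth n fin) (simp_all add: sp)
    moreover have "(\<Sum>e\<in>E. (orth_proj S b \<bullet> e) *\<^sub>R e) = (\<Sum>e\<in>E. (b \<bullet> e) *\<^sub>R e)"
      by (intro sum.cong refl) (simp add: orth_proj_inner[OF S subsetD[OF \<open>E \<subseteq> S\<close>]])
    ultimately show ?thesis by simp
  qed
  have "(\<Sum>b\<in>Basis. B' (orth_proj S b) b) = (\<Sum>b\<in>Basis. \<Sum>e\<in>E. (b \<bullet> e) *\<^sub>R B' e b)"
    unfolding P by (simp only: linear_sum[OF l1] linear_scale[OF l1])
  also have "\<dots> = (\<Sum>e\<in>E. \<Sum>b\<in>Basis. (e \<bullet> b) *\<^sub>R B' e b)"
    by (subst sum.swap) (simp only: inner_commute)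
  also have "\<dots> = (\<Sum>e\<in>E. B' e (\<Sum>b\<in>Basis. (e \<bullet> b) *\<^sub>R b))"
    by (simp only: linear_sum[OF l2] linear_scale[OF l2])
  also have "\<dots> = (\<Sum>e\<in>E. B e e)"
    by (intro sum.cong refl)
      (simp add: euclidean_representation assms(2)[OF subsetD[OF \<open>E \<subseteq> S\<close>] subsetD[OF \<open>E \<subseteq> S\<close>]])
  finally show ?thesis
    by (simp add: trace_over_def E_def)
qed

text \<open>Both sides are the trace of the inner product on \<open>S\<close>: once in an
  orthonormal basis, once by \<open>trace_over_eq\<close>.\<close>

lemma sum_orth_proj_inner:
  assumes S: "subspace S"
  shows "(\<Sum>b\<in>Basis. orth_proj S b \<bullet> b) = real (dim S)"
proof -
  have E: "orthonormal_basis_of S (SOME E. orthonormal_basis_of S E)" (is "orthonormal_basis_of S ?E")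
    by (rule some_orthonormal_basis_of[OF S])
  then have "independent ?E"
    by (intro pairwise_orthogonal_independent) (auto simp: orthonormal_basis_of_def)
  then have "card ?E = dim S"
    using E dim_eq_card_independent[of ?E] dim_span[of ?E] by (simp add: orthonormal_basis_of_def)
  moreover have "trace_over S (\<bullet>) = real (card ?E)"
    using E by (simp add: trace_over_def orthonormal_basis_of_def dot_square_norm)
  moreover have "trace_over S (\<bullet>) = (\<Sum>b\<in>Basis. orth_proj S b \<bullet> b)"
    by (rule trace_over_eq[OF S]) (auto intro!: linearI simp: inner_simps)
  ultimately show ?thesis by simp
qed

section \<open>Derivatives along a submanifold\<close>

text \<open>Curves are the test objects, as in \<open>dir_deriv\<close>. The map \<open>D\<close>
  lives on the whole ambient space but is determined only on tangent vectors, so later statements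
  ask for some \<open>D\<close>.\<close>

definition has_mderiv ::
    "'a::euclidean_space topology \<Rightarrow> ('a \<Rightarrow> 'b::real_normed_vector) \<Rightarrow> 'a \<Rightarrow> ('a \<Rightarrow> 'b) \<Rightarrow> bool" where
  "has_mderiv M F p D \<longleftrightarrow> bounded_linear D \<and>
     (\<forall>v \<gamma>. curve_at M p v \<gamma> \<longrightarrow> ((\<lambda>t. F (\<gamma> t)) has_vector_derivative D v) (at 0))"

definition mdiff :: "'a::euclidean_space topology \<Rightarrow> ('a \<Rightarrow> 'b::real_normed_vector) \<Rightarrow> bool" where
  "mdiff M F \<longleftrightarrow> (\<forall>p\<in>topspace M. \<exists>D. has_mderiv M F p D)"

text \<open>The operator \<open>\<delta>\<^sub>w\<close> of the overview. Projecting the direction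
  first makes it meaningful for every ambient \<open>w\<close>, so it can be iterated and summed
  over \<open>Basis\<close>.\<close>

definition tderiv ::
    "'a::euclidean_space topology \<Rightarrow> 'a \<Rightarrow> ('a \<Rightarrow> 'b::real_normed_vector) \<Rightarrow> 'a \<Rightarrow> 'b" where
  "tderiv M w F q = dir_deriv M F q (tan_ext M w q)"

text \<open>Curves are continuous into the manifold topology, so the preimage of \<open>U\<close> is
  open even when that topology is finer than the subspace topology.\<close>

lemma curve_at_in_open:
  assumes "curve_at M p v \<gamma>" "openin M U" "p \<in> U"
  obtains e where "e > 0" "\<And>t. \<bar>t\<bar> < e \<Longrightarrow> \<gamma> t \<in> U" "continuous_map (top_of_set {-e<..<e}) M \<gamma>"
proof -
  from assms(1) obtain d where d: "d > 0" "continuous_map (top_of_set {-d<..<d}) M \<gamma>" and g0: "\<gamma> 0 = p"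
    by (auto simp: curve_at_def)
  have "openin (top_of_set {-d<..<d}) {t \<in> topspace (top_of_set {-d<..<d}). \<gamma> t \<in> U}"
    using d(2) assms(2) by (rule openin_continuous_map_preimage)
  then have "open {t \<in> {-d<..<d}. \<gamma> t \<in> U}"
    by (simp add: openin_open_eq)
  moreover have "0 \<in> {t \<in> {-d<..<d}. \<gamma> t \<in> U}"
    using d g0 assms by auto
  ultimately obtain e where e: "e > 0" "ball 0 e \<subseteq> {t \<in> {-d<..<d}. \<gamma> t \<in> U}"
    using open_contains_ball by blast
  have sub: "{-e<..<e} \<subseteq> ball 0 e"
    by (auto simp: dist_real_def)
  show thesis
  proof (rule that[OF e(1)])
    show "\<gamma> t \<in> U" if "\<bar>t\<bar> < e" for t
      using that e(2) by (auto simp: dist_real_def)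
    have "{-e<..<e} \<subseteq> {-d<..<d}"
      using sub e(2) by blast
    then show "continuous_map (top_of_set {-e<..<e}) M \<gamma>"
      using continuous_map_from_subtopology_mono[OF d(2)] by blast
  qed
qed

lemma curve_at_in_topspace:
  assumes "curve_at M p v \<gamma>"
  obtains e where "e > 0" "\<And>t. \<bar>t\<bar> < e \<Longrightarrow> \<gamma> t \<in> topspace M"
proof -
  from assms obtain d where "d > 0" "continuous_map (top_of_set {-d<..<d}) M \<gamma>" "\<gamma> 0 = p"
    by (auto simp: curve_at_def)
  then have "p \<in> topspace M"
    by (auto simp: continuous_map_def Pi_iff)
  then show thesis
    using curve_at_in_open[OF assms openin_topspace] that by metis
qed

lemma has_mderiv_cong:
  assumes "has_mderiv M F p D" "\<And>q. q \<in> topspace M \<Longrightarrow> F q = G q"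
  shows "has_mderiv M G p D"
  unfolding has_mderiv_def
proof (intro conjI allI impI)
  show "bounded_linear D" using assms by (simp add: has_mderiv_def)
  fix v \<gamma> assume c: "curve_at M p v \<gamma>"
  then obtain e where e: "e > 0" "\<And>t. \<bar>t\<bar> < e \<Longrightarrow> \<gamma> t \<in> topspace M"
    by (rule curve_at_in_topspace) blast
  show "((\<lambda>t. G (\<gamma> t)) has_vector_derivative D v) (at 0)"
    by (rule has_vector_derivative_transform_within_open[where f="\<lambda>t. F (\<gamma> t)" and S="{-e<..<e}"])
      (use assms c e in \<open>auto simp: has_mderiv_def\<close>)
qed

lemma mdiff_cong:
  assumes "mdiff M F" "\<And>q. q \<in> topspace M \<Longrightarrow> F q = G q"
  shows "mdiff M G"
  using assms has_mderiv_cong unfolding mdiff_def by blast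

text \<open>A tangent vector has at least one curve, and uniqueness of the derivative along it pins
  down the definite description.\<close>

lemma dir_deriv_eq:
  assumes "has_mderiv M F p D" "v \<in> tangent_space M p"
  shows "dir_deriv M F p v = D v"
proof -
  from assms(2) obtain \<gamma> where g: "curve_at M p v \<gamma>"
    by (auto simp: tangent_space_def)
  show ?thesis
    unfolding dir_deriv_def
    using assms(1) g unfolding has_mderiv_def
    by (intro the_equality) (auto intro: vector_derivative_unique_at)
qed

lemma has_mderiv_ident: "has_mderiv M (\<lambda>q. q) p (\<lambda>v. v)"
  by (auto simp: has_mderiv_def curve_at_def bounded_linear_ident)

lemma has_mderiv_const: "has_mderiv M (\<lambda>q. c) p (\<lambda>v. 0)"
  by (auto simp: has_mderiv_def bounded_linear_zero)

lemma has_mderiv_add: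
  "has_mderiv M F p D \<Longrightarrow> has_mderiv M G p D' \<Longrightarrow> has_mderiv M (\<lambda>q. F q + G q) p (\<lambda>v. D v + D' v)"
  by (auto simp: has_mderiv_def bounded_linear_add intro!: derivative_intros)

lemma has_mderiv_bilinear:
  assumes "bounded_bilinear h" "has_mderiv M F p D" "has_mderiv M G p D'"
  shows "has_mderiv M (\<lambda>q. h (F q) (G q)) p (\<lambda>v. h (F p) (D' v) + h (D v) (G p))"
  unfolding has_mderiv_def
proof (intro conjI allI impI)
  show "bounded_linear (\<lambda>v. h (F p) (D' v) + h (D v) (G p))"
    using assms unfolding has_mderiv_def
    by (intro bounded_linear_add bounded_linear_compose[OF bounded_bilinear.bounded_linear_right[OF assms(1)]]
      bounded_linear_compose[OF bounded_bilinear.bounded_linear_left[OF assms(1)]]) auto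
  fix v \<gamma> assume c: "curve_at M p v \<gamma>"
  then have "\<gamma> 0 = p" by (simp add: curve_at_def)
  with bounded_bilinear.has_vector_derivative[OF assms(1), of "\<lambda>t. F (\<gamma> t)" "D v" 0 UNIV "\<lambda>t. G (\<gamma> t)" "D' v"]
  show "((\<lambda>t. h (F (\<gamma> t)) (G (\<gamma> t))) has_vector_derivative h (F p) (D' v) + h (D v) (G p)) (at 0)"
    using assms c by (auto simp: has_mderiv_def)
qed

section \<open>Local parametrizations\<close>

text \<open>Stands in for the inverse function theorem. Near \<open>c 0\<close> the map
  \<open>f\<close> distorts increments by at most half their length, so a continuous
  \<open>c\<close> is first Lipschitz at 0 and then differentiable there.\<close>

lemma has_vector_derivative_through_id:
  fixes c :: "real \<Rightarrow> 'b::real_normed_vector"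
  assumes f: "(f has_derivative (\<lambda>z. z)) (at (c 0))" and c: "isCont c 0"
    and fc: "((\<lambda>t. f (c t)) has_vector_derivative w) (at 0)"
  shows "(c has_vector_derivative w) (at 0)"
  unfolding has_vector_derivative_def has_derivative_at_alt
proof (intro conjI allI impI)
  show "bounded_linear (\<lambda>t. t *\<^sub>R w)"
    by (rule bounded_linear_scaleR_left)
  fix e :: real assume "e > 0"
  define K where "K = norm w + 1"
  have "K > 0" by (simp add: K_def add_nonneg_pos)
  \<comment> \<open>With \<open>e1 \<le> 1/2\<close> the increment of \<open>c\<close> is at most
    twice that of \<open>f \<circ> c\<close>, hence at most \<open>2 * K * norm t\<close>; the bound
    by \<open>K\<close> uses \<open>e2 \<le> 1\<close>. The two errors then contribute at most
    \<open>e / 2\<close> each.\<close>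
  define e1 where "e1 = min (1/2) (e / (4 * K))"
  define e2 where "e2 = min 1 (e / 2)"
  have e1: "e1 > 0" "e1 \<le> 1/2" "e1 * (2 * K) \<le> e / 2" and e2: "e2 > 0" "e2 \<le> 1" "e2 \<le> e / 2"
    using \<open>e > 0\<close> \<open>K > 0\<close> by (auto simp: e1_def e2_def min_def field_simps)
  obtain d1 where d1: "d1 > 0"
    "\<And>z. norm (z - c 0) < d1 \<Longrightarrow> norm (f z - f (c 0) - (z - c 0)) \<le> e1 * norm (z - c 0)"
    using f e1(1) unfolding has_derivative_at_alt by blast
  obtain d2 where d2: "d2 > 0" "\<And>t::real. norm t < d2 \<Longrightarrow> norm (c t - c 0) < d1"
    using c d1(1) unfolding continuous_at_eps_delta dist_norm by auto
  obtain d3 where d3: "d3 > 0"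
    "\<And>t::real. norm t < d3 \<Longrightarrow> norm (f (c t) - f (c 0) - t *\<^sub>R w) \<le> e2 * norm t"
    using fc e2(1) unfolding has_vector_derivative_def has_derivative_at_alt by auto
  show "\<exists>d>0. \<forall>t. norm (t - 0) < d \<longrightarrow> norm (c t - c 0 - (t - 0) *\<^sub>R w) \<le> e * norm (t - 0)"
  proof (intro exI[of _ "min d2 d3"] conjI allI impI)
    show "min d2 d3 > 0" using d2 d3 by simp
    fix t :: real assume "norm (t - 0) < min d2 d3"
    then have t: "norm t < d2" "norm t < d3" by auto
    let ?y = "f (c t) - f (c 0)"
    have a: "norm (?y - (c t - c 0)) \<le> e1 * norm (c t - c 0)"
      using d1(2) d2(2) t by blast
    also have "\<dots> \<le> 1/2 * norm (c t - c 0)"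
      using e1 by (intro mult_right_mono) auto
    finally have b: "norm (?y - (c t - c 0)) \<le> 1/2 * norm (c t - c 0)" .
    have y: "norm (?y - t *\<^sub>R w) \<le> e2 * norm t"
      using d3 t by blast
    have "norm ?y \<le> norm (?y - t *\<^sub>R w) + norm (t *\<^sub>R w)"
      by (rule order_trans[OF _ norm_triangle_ineq]) simp
    also have "\<dots> \<le> 1 * norm t + norm t * norm w"
      using y mult_right_mono[OF e2(2), of "norm t"] by simp
    finally have "norm ?y \<le> K * norm t"
      by (simp add: K_def algebra_simps)
    moreover have "norm (c t - c 0) \<le> norm ?y + norm (?y - (c t - c 0))"
      using norm_triangle_ineq4[of ?y "?y - (c t - c 0)"] by simp
    ultimately have "norm (c t - c 0) \<le> 2 * K * norm t"
      using b by linarith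
    with a have "norm (?y - (c t - c 0)) \<le> e1 * (2 * K * norm t)"
      by (meson e1(1) less_imp_le mult_left_mono order_trans)
    also have "\<dots> = e1 * (2 * K) * norm t" by simp
    also have "\<dots> \<le> e / 2 * norm t"
      using e1(3) by (rule mult_right_mono) simp
    finally have "norm (?y - (c t - c 0)) \<le> e / 2 * norm t" .
    moreover have "norm (?y - t *\<^sub>R w) \<le> e / 2 * norm t"
      by (rule order_trans[OF y mult_right_mono[OF e2(3) norm_ge_zero]])
    moreover have "norm (c t - c 0 - t *\<^sub>R w) \<le> norm (?y - t *\<^sub>R w) + norm (?y - (c t - c 0))"
      using norm_triangle_ineq4[of "?y - t *\<^sub>R w" "?y - (c t - c 0)"] by (simp add: algebra_simps)
    ultimately show "norm (c t - c 0 - (t - 0) *\<^sub>R w) \<le> e * norm (t - 0)"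
      unfolding diff_zero using field_sum_of_halves[of "e * norm t"] by simp
  qed
qed

lemma smooth_on_differentiable:
  assumes "smooth_on S f" "u \<in> S"
  shows "f differentiable (at u)" and "(\<lambda>u. frechet_derivative f (at u) a) differentiable (at u)"
proof -
  have "Ck_on (Suc (Suc 0)) S f"
    using assms(1) by (simp add: smooth_on_def del: Ck_on.simps)
  then show "f differentiable (at u)" "(\<lambda>u. frechet_derivative f (at u) a) differentiable (at u)"
    using assms(2) by auto
qed

lemma smooth_on_has_derivative:
  "smooth_on S f \<Longrightarrow> u \<in> S \<Longrightarrow> (f has_derivative frechet_derivative f (at u)) (at u)"
  by (rule frechet_derivative_works[THEN iffD1, OF smooth_on_differentiable(1)])

lemma local_paramD:
  assumes "local_param M V x"
  shows "open V" "smooth_on V x" "u \<in> V \<Longrightarrow> inj (frechet_derivative x (at u))"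
    "openin M (x ` V)" "x ` V \<subseteq> topspace M"
  using assms openin_subset[of M "x ` V"] by (auto simp: local_param_def)

lemma linear_local_param:
  assumes "local_param M V x" "u \<in> V"
  shows "linear (frechet_derivative x (at u))"
  using smooth_on_has_derivative[OF local_paramD(2)[OF assms(1)] assms(2)] by (rule has_derivative_linear)

lemma local_param_curve_at:
  assumes lp: "local_param M V x" and u: "u \<in> V"
  shows "curve_at M (x u) (frechet_derivative x (at u) a) (\<lambda>t. x (u + t *\<^sub>R a))"
proof -
  have cm: "continuous_map (top_of_set V) M x"
    using lp homeomorphic_imp_continuous_map[of "top_of_set V" "subtopology M (x ` V)" x]
    by (simp add: local_param_def continuous_map_in_subtopology)
  have co: "continuous_on UNIV (\<lambda>t. u + t *\<^sub>R a)"
    by (intro continuous_intros)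
  have "open ((\<lambda>t. u + t *\<^sub>R a) -` V)"
    using open_vimage[OF local_paramD(1)[OF lp] co] .
  then obtain e where e: "e > 0" "ball 0 e \<subseteq> (\<lambda>t. u + t *\<^sub>R a) -` V"
    using u open_contains_ball by (metis (no_types, lifting) add.right_neutral scale_zero_left vimageI)
  have "continuous_map (top_of_set {-e<..<e}) (top_of_set V) (\<lambda>t. u + t *\<^sub>R a)"
    using e(2) continuous_on_subset[OF co] by (auto simp: dist_real_def subset_iff)
  from continuous_map_compose[OF this cm]
  have "continuous_map (top_of_set {-e<..<e}) M (\<lambda>t. x (u + t *\<^sub>R a))"
    by (simp add: o_def)
  moreover have "((\<lambda>t. x (u + t *\<^sub>R a)) has_vector_derivative frechet_derivative x (at u) a) (at 0)"
  proof -
    have "((\<lambda>t. u + t *\<^sub>R a) has_vector_derivative a) (at (0::real))"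
      by (auto intro!: derivative_eq_intros)
    moreover have "(x has_derivative frechet_derivative x (at u)) (at (u + 0 *\<^sub>R a))"
      using smooth_on_has_derivative[OF local_paramD(2)[OF lp] u] by simp
    ultimately show ?thesis
      using vector_derivative_diff_chain_within[of "\<lambda>t. u + t *\<^sub>R a" a 0 UNIV x, OF _ has_derivative_at_withinI]
      by (simp add: o_def)
  qed
  ultimately show ?thesis
    using e(1) by (auto simp: curve_at_def)
qed

text \<open>The lift is \<open>h \<circ> \<gamma>\<close> for the inverse homeomorphism
  \<open>h\<close>, a priori only continuous. Since \<open>g \<circ> x\<close> has the identity as
  derivative at \<open>u\<close>, \<open>has_vector_derivative_through_id\<close> makes the lift
  differentiable.\<close>

lemma curve_at_lift:
  assumes lp: "local_param M V x" and u: "u \<in> V" and cu: "curve_at M (x u) v \<gamma>"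
    and g: "linear g" "\<And>a. g (frechet_derivative x (at u) a) = a"
  obtains c e where "(c has_vector_derivative g v) (at 0)" "c 0 = u" "e > 0"
    "\<And>t. \<bar>t\<bar> < e \<Longrightarrow> c t \<in> V \<and> x (c t) = \<gamma> t"
proof -
  from lp obtain h where "homeomorphic_maps (top_of_set V) (subtopology M (x ` V)) x h"
    unfolding local_param_def homeomorphic_map_maps by blast
  then have h: "continuous_map (subtopology M (x ` V)) (top_of_set V) h"
    "\<And>z. z \<in> V \<Longrightarrow> h (x z) = z"
    by (auto simp: homeomorphic_maps_def)
  obtain e where e: "e > 0" "\<And>t. \<bar>t\<bar> < e \<Longrightarrow> \<gamma> t \<in> x ` V" "continuous_map (top_of_set {-e<..<e}) M \<gamma>"
    using curve_at_in_open[OF cu local_paramD(4)[OF lp]] u by blast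
  define c where "c = (\<lambda>t. h (\<gamma> t))"
  have "continuous_map (top_of_set {-e<..<e}) (subtopology M (x ` V)) \<gamma>"
    using e by (auto simp: continuous_map_in_subtopology)
  from continuous_map_compose[OF this h(1)]
  have "continuous_on {-e<..<e} c"
    by (simp add: c_def o_def)
  then have cont: "isCont c 0"
    using e(1) by (simp add: continuous_on_eq_continuous_at)
  have g0: "\<gamma> 0 = x u" and gv: "(\<gamma> has_vector_derivative v) (at 0)"
    using cu by (auto simp: curve_at_def)
  have c0: "c 0 = u"
    using g0 h(2) u by (simp add: c_def)
  have cV: "c t \<in> V \<and> x (c t) = \<gamma> t" if "\<bar>t\<bar> < e" for t
    using e(2)[OF that] h(2) by (auto simp: c_def)
  have bl: "bounded_linear g"
    using g(1) linear_conv_bounded_linear by blast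
  have "((\<lambda>z. g (x z)) has_derivative (\<lambda>a. g (frechet_derivative x (at u) a))) (at u)"
    by (rule bounded_linear.has_derivative[OF bl smooth_on_has_derivative[OF local_paramD(2)[OF lp] u]])
  then have gx: "((\<lambda>z. g (x z)) has_derivative (\<lambda>a. a)) (at (c 0))"
    by (simp add: g c0)
  have "((\<lambda>t. g (x (c t))) has_vector_derivative g v) (at 0)"
    by (rule has_vector_derivative_transform_within_open[where f="\<lambda>t. g (\<gamma> t)" and S="{-e<..<e}"])
      (use e(1) cV in \<open>auto intro: bounded_linear.has_vector_derivative[OF bl gv]\<close>)
  from has_vector_derivative_through_id[OF gx cont this]
  have "(c has_vector_derivative g v) (at 0)" .
  then show thesis
    using that c0 e(1) cV by blast
qed

lemma tangent_space_local_param: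
  assumes lp: "local_param M V x" and u: "u \<in> V"
  shows "tangent_space M (x u) = range (frechet_derivative x (at u))"
proof
  show "range (frechet_derivative x (at u)) \<subseteq> tangent_space M (x u)"
    using local_param_curve_at[OF assms] by (auto simp: tangent_space_def)
  show "tangent_space M (x u) \<subseteq> range (frechet_derivative x (at u))"
  proof
    fix v assume "v \<in> tangent_space M (x u)"
    then obtain \<gamma> where cu: "curve_at M (x u) v \<gamma>"
      by (auto simp: tangent_space_def)
    obtain g where g: "linear g" "g \<circ> frechet_derivative x (at u) = id"
      using linear_injective_left_inverse[OF linear_local_param[OF assms] local_paramD(3)[OF assms]] by blast
    then have "\<And>a. g (frechet_derivative x (at u) a) = a"
      by (simp add: fun_eq_iff)
    from curve_at_lift[OF assms cu g(1) this] obtain c e where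
      c: "(c has_vector_derivative g v) (at 0)" "c 0 = u" "e > 0"
        "\<And>t. \<bar>t\<bar> < e \<Longrightarrow> c t \<in> V \<and> x (c t) = \<gamma> t"
      by blast
    have "((x \<circ> c) has_vector_derivative frechet_derivative x (at u) (g v)) (at 0)"
      by (rule vector_derivative_diff_chain_within[OF c(1) has_derivative_at_withinI])
        (simp add: c(2) smooth_on_has_derivative[OF local_paramD(2)[OF lp] u])
    then have "(\<gamma> has_vector_derivative frechet_derivative x (at u) (g v)) (at 0)"
      by (rule has_vector_derivative_transform_within_open[where S="{-e<..<e}"]) (use c in auto)
    with cu have "v = frechet_derivative x (at u) (g v)"
      unfolding curve_at_def using vector_derivative_unique_at by blast
    then show "v \<in> range (frechet_derivative x (at u))"
      by blast
  qed
qed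

text \<open>Take \<open>D = F' \<circ> g\<close> for a linear left inverse \<open>g\<close> of the
  differential of \<open>x\<close>, and apply the chain rule to \<open>F \<circ> x\<close> along the
  lifted curve.\<close>

lemma has_mderiv_local_param:
  assumes lp: "local_param M V x" and u: "u \<in> V" and F: "((F \<circ> x) has_derivative F') (at u)"
  shows "\<exists>D. has_mderiv M F (x u) D \<and> (\<forall>a. D (frechet_derivative x (at u) a) = F' a)"
proof -
  obtain g where g: "linear g" "g \<circ> frechet_derivative x (at u) = id"
    using linear_injective_left_inverse[OF linear_local_param[OF lp u] local_paramD(3)[OF lp u]] by blast
  then have gx: "g (frechet_derivative x (at u) a) = a" for a
    by (simp add: fun_eq_iff)
  have "has_mderiv M F (x u) (\<lambda>v. F' (g v))"
    unfolding has_mderiv_def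
  proof (intro conjI allI impI)
    show "bounded_linear (\<lambda>v. F' (g v))"
      using bounded_linear_compose[OF has_derivative_bounded_linear[OF F] g(1)[unfolded linear_conv_bounded_linear]] .
    fix v \<gamma> assume "curve_at M (x u) v \<gamma>"
    from curve_at_lift[OF lp u this g(1) gx] obtain c e where
      c: "(c has_vector_derivative g v) (at 0)" "c 0 = u" "e > 0"
        "\<And>t. \<bar>t\<bar> < e \<Longrightarrow> c t \<in> V \<and> x (c t) = \<gamma> t"
      by blast
    have "((F \<circ> x \<circ> c) has_vector_derivative F' (g v)) (at 0)"
      by (rule vector_derivative_diff_chain_within[OF c(1) has_derivative_at_withinI]) (simp add: c(2) F[unfolded o_def] o_def)
    then show "((\<lambda>t. F (\<gamma> t)) has_vector_derivative F' (g v)) (at 0)"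
      by (rule has_vector_derivative_transform_within_open[where S="{-e<..<e}"]) (use c(3,4) in auto)
  qed
  then show ?thesis
    using gx by auto
qed

section \<open>Differentiability of the tangential projection and of tangential derivatives\<close>

lemma det_differentiable:
  fixes f :: "'n::finite \<Rightarrow> 'n \<Rightarrow> 'v::real_normed_vector \<Rightarrow> real"
  assumes "\<And>i j. f i j differentiable (at u)"
  shows "(\<lambda>u. det (\<chi> i j. f i j u)) differentiable (at u)"
proof -
  obtain f' where "\<And>i j. (f i j has_derivative f' i j) (at u)"
    using assms unfolding differentiable_def by metis
  then have "((\<lambda>u. \<Sum>p | p permutes UNIV. of_int (sign p) * (\<Prod>i\<in>UNIV. f i (p i) u)) has_derivative
      (\<lambda>y. \<Sum>p | p permutes UNIV. of_int (sign p) *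
        (\<Sum>i\<in>UNIV. f' i (p i) y * (\<Prod>j\<in>UNIV - {i}. f j (p j) u)))) (at u)"
    by (intro has_derivative_sum has_derivative_mult_right has_derivative_prod) auto
  then show ?thesis
    unfolding differentiable_def det_def by auto
qed

definition coord_vec :: "(real^'m::finite \<Rightarrow> 'b::real_normed_vector) \<Rightarrow> 'm \<Rightarrow> real^'m \<Rightarrow> 'b" where
  "coord_vec x i u = frechet_derivative x (at u) (axis i 1)"

text \<open>The first fundamental form in the coordinates given by \<open>x\<close>.\<close>

definition gram :: "(real^'m::finite \<Rightarrow> 'a::euclidean_space) \<Rightarrow> real^'m \<Rightarrow> real^'m^'m" where
  "gram x u = (\<chi> i j. coord_vec x i u \<bullet> coord_vec x j u)"

text \<open>Cramer's rule for the normal equations of the projection onto the tangent space; being rational in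
  first derivatives, these coefficients are visibly differentiable.\<close>

definition proj_coeff :: "(real^'m::finite \<Rightarrow> 'a::euclidean_space) \<Rightarrow> 'a \<Rightarrow> 'm \<Rightarrow> real^'m \<Rightarrow> real" where
  "proj_coeff x w k u =
     det (\<chi> i j. if j = k then w \<bullet> coord_vec x i u else coord_vec x i u \<bullet> coord_vec x j u) / det (gram x u)"

lemma frechet_derivative_coord_vec:
  assumes "linear (frechet_derivative x (at u))"
  shows "frechet_derivative x (at u) a = (\<Sum>i\<in>UNIV. a $ i *\<^sub>R coord_vec x i u)"
proof -
  have "frechet_derivative x (at u) a = frechet_derivative x (at u) (\<Sum>i\<in>UNIV. a $ i *\<^sub>R axis i 1)"
    using basis_expansion[of a] by (simp add: scalar_mult_eq_scaleR)
  then show ?thesis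
    by (simp add: linear_sum[OF assms] linear_scale[OF assms] coord_vec_def)
qed

text \<open>A kernel vector of the Gram matrix has an image under the injective differential that is
  orthogonal to itself, so the matrix is invertible. Cramer's rule then solves the normal equations,
  which characterise the projection.\<close>

lemma
  assumes lp: "local_param M V x" and u: "u \<in> V"
  shows det_gram: "det (gram x u) \<noteq> 0"
    and subspace_tangent_param: "subspace (tangent_space M (x u))"
    and tan_ext_local_param:
      "tan_ext M w (x u) = frechet_derivative x (at u) (\<chi> k. proj_coeff x w k u)"
proof -
  let ?x' = "frechet_derivative x (at u)"
  have lin: "linear ?x'"
    by (rule linear_local_param[OF assms])
  have inner: "?x' a \<bullet> coord_vec x i u = (gram x u *v a) $ i" for a i
    unfolding frechet_derivative_coord_vec[OF lin, of a] inner_sum_left inner_scaleR_left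
    by (simp add: gram_def matrix_vector_mult_def inner_commute mult.commute)
  show det: "det (gram x u) \<noteq> 0"
  proof -
    have "a = 0" if "gram x u *v a = 0" for a
    proof -
      have "?x' a \<bullet> ?x' a = (\<Sum>i\<in>UNIV. a $ i * (?x' a \<bullet> coord_vec x i u))"
        by (subst (2) frechet_derivative_coord_vec[OF lin]) (simp add: inner_sum_right)
      also have "\<dots> = 0"
        by (simp add: inner that)
      finally have "?x' a = 0" by simp
      then show "a = 0"
        using local_paramD(3)[OF assms] linear_injective_0[OF lin] by blast
    qed
    then have "\<exists>B. B ** gram x u = mat 1"
      by (simp add: matrix_left_invertible_ker)
    then show ?thesis
      using invertible_left_inverse invertible_det_nz by blast
  qed
  have T: "tangent_space M (x u) = range ?x'"
    by (rule tangent_space_local_param[OF assms])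
  show S: "subspace (tangent_space M (x u))"
    unfolding T by (rule linear_subspace_image[OF lin subspace_UNIV])
  let ?a = "\<chi> k. proj_coeff x w k u"
  have "?a = (\<chi> k. det (\<chi> i j. if j = k then (\<chi> i. w \<bullet> coord_vec x i u) $ i else gram x u $ i $ j) / det (gram x u))"
    by (simp add: proj_coeff_def gram_def cong: if_cong)
  then have "gram x u *v ?a = (\<chi> i. w \<bullet> coord_vec x i u)"
    using cramer[OF det] by blast
  then have i0: "?x' ?a \<bullet> coord_vec x i u = w \<bullet> coord_vec x i u" for i
    by (simp add: inner)
  show "tan_ext M w (x u) = ?x' ?a"
    unfolding tan_ext_def
  proof (rule orth_proj_eqI[OF S])
    show "?x' ?a \<in> tangent_space M (x u)"
      by (simp add: T)
    fix v assume "v \<in> tangent_space M (x u)"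
    then obtain b where v: "v = ?x' b"
      by (auto simp: T)
    show "(w - ?x' ?a) \<bullet> v = 0"
      unfolding v frechet_derivative_coord_vec[OF lin, of b]
      by (simp add: inner_sum_right inner_diff_left i0)
  qed
qed

lemma proj_coeff_differentiable:
  assumes lp: "local_param M V x" and u: "u \<in> V"
  shows "proj_coeff x w k differentiable (at u)"
proof -
  have X: "coord_vec x i differentiable (at u)" for i
    unfolding coord_vec_def[abs_def] by (rule smooth_on_differentiable(2)[OF local_paramD(2)[OF lp] u])
  have XX: "(\<lambda>u. coord_vec x i u \<bullet> coord_vec x j u) differentiable (at u)" for i j
    by (rule differentiable_inner[OF X X])
  have "(\<lambda>u. det (gram x u)) differentiable (at u)"
    unfolding gram_def by (rule det_differentiable[OF XX])
  \<comment> \<open>The case distinction on the column is moved outside the argument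
    \<open>u\<close>, so that \<open>det_differentiable\<close> sees each matrix entry as a function
    of \<open>u\<close>.\<close>
  moreover have "(\<lambda>u. det (\<chi> i j. (if j = k then (\<lambda>u. w \<bullet> coord_vec x i u)
      else (\<lambda>u. coord_vec x i u \<bullet> coord_vec x j u)) u)) differentiable (at u)"
    by (rule det_differentiable) (auto intro: XX differentiable_inner X)
  moreover have "(\<lambda>u. det (\<chi> i j. (if j = k then (\<lambda>u. w \<bullet> coord_vec x i u)
      else (\<lambda>u. coord_vec x i u \<bullet> coord_vec x j u)) u)) =
    (\<lambda>u. det (\<chi> i j. if j = k then w \<bullet> coord_vec x i u else coord_vec x i u \<bullet> coord_vec x j u))"
    by (intro ext arg_cong[where f=det]) (simp add: vec_eq_iff)
  ultimately show ?thesis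
    unfolding proj_coeff_def[abs_def] using det_gram[OF assms] by (intro differentiable_divide) simp_all
qed

lemma tderiv_local_param:
  assumes lp: "local_param M V x" and F: "smooth_on V (F \<circ> x)" and u: "u \<in> V"
  shows "tderiv M w F (x u) = (\<Sum>k\<in>UNIV. proj_coeff x w k u *\<^sub>R coord_vec (F \<circ> x) k u)"
proof -
  have F': "((F \<circ> x) has_derivative frechet_derivative (F \<circ> x) (at u)) (at u)"
    by (rule smooth_on_has_derivative[OF F u])
  from has_mderiv_local_param[OF lp u F'] obtain D where
    D: "has_mderiv M F (x u) D" "\<And>a. D (frechet_derivative x (at u) a) = frechet_derivative (F \<circ> x) (at u) a"
    by blast
  show ?thesis
    unfolding tderiv_def tan_ext_local_param[OF lp u]
    using dir_deriv_eq[OF D(1)] frechet_derivative_coord_vec[OF has_derivative_linear[OF F']]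
    by (simp add: tangent_space_local_param[OF lp u] D(2))
qed

text \<open>In coordinates \<open>tderiv M w F\<close> is a sum of products of projection
  coefficients with first partial derivatives of \<open>F\<close>, all differentiable. This converts
  smoothness in charts into the regularity \<open>mdiff2\<close> of the later calculus.\<close>

lemma smooth_map_on_mdiff:
  fixes M :: "'a::euclidean_space topology"
  assumes M: "submanifold TYPE('m::finite) M" and F: "smooth_map_on TYPE('m) M F"
  shows "mdiff M F" and "mdiff M (tderiv M w F)"
proof -
  have *: "(\<exists>D. has_mderiv M F p D) \<and> (\<exists>D. has_mderiv M (tderiv M w F) p D)" if "p \<in> topspace M" for p
  proof -
    from M that obtain V and x :: "real^'m \<Rightarrow> 'a" where lp: "local_param M V x" and "p \<in> x ` V"
      unfolding submanifold_def by blast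
    then obtain u where u: "u \<in> V" and p: "p = x u"
      by blast
    have Fx: "smooth_on V (F \<circ> x)"
      using F lp by (simp add: smooth_map_on_def)
    have "\<exists>D. has_mderiv M F p D"
      using has_mderiv_local_param[OF lp u smooth_on_has_derivative[OF Fx u]] p by blast
    moreover have "(\<lambda>u. \<Sum>k\<in>UNIV. proj_coeff x w k u *\<^sub>R coord_vec (F \<circ> x) k u) differentiable (at u)"
    proof (intro differentiable_sum ballI)
      fix k :: 'm
      have "coord_vec (F \<circ> x) k differentiable (at u)"
        unfolding coord_vec_def[abs_def] by (rule smooth_on_differentiable(2)[OF Fx u])
      then show "(\<lambda>u. proj_coeff x w k u *\<^sub>R coord_vec (F \<circ> x) k u) differentiable (at u)"
        by (rule differentiable_scaleR[OF proj_coeff_differentiable[OF lp u]])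
    qed simp
    then obtain G where "((\<lambda>u. \<Sum>k\<in>UNIV. proj_coeff x w k u *\<^sub>R coord_vec (F \<circ> x) k u) has_derivative G) (at u)"
      unfolding differentiable_def by blast
    then have "((tderiv M w F \<circ> x) has_derivative G) (at u)"
      by (rule has_derivative_transform_within_open[OF _ local_paramD(1)[OF lp] u])
        (simp add: tderiv_local_param[OF lp Fx])
    then have "\<exists>D. has_mderiv M (tderiv M w F) p D"
      using has_mderiv_local_param[OF lp u] p by blast
    ultimately show ?thesis by blast
  qed
  then show "mdiff M F" "mdiff M (tderiv M w F)"
    by (auto simp: mdiff_def)
qed

lemma tangent_space_submanifold:
  fixes M :: "'a::euclidean_space topology"
  assumes M: "submanifold TYPE('m::finite) M" and p: "p \<in> topspace M"
  shows "subspace (tangent_space M p)" and "dim (tangent_space M p) = CARD('m)"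
proof -
  from M p obtain V and x :: "real^'m \<Rightarrow> 'a" where lp: "local_param M V x" and "p \<in> x ` V"
    unfolding submanifold_def by blast
  then obtain u where u: "u \<in> V" and p: "p = x u"
    by blast
  show "subspace (tangent_space M p)"
    unfolding p by (rule subspace_tangent_param[OF lp u])
  have "dim (range (frechet_derivative x (at u))) = dim (UNIV :: (real^'m) set)"
    by (rule dim_image_eq[OF linear_local_param[OF lp u]]) (use local_paramD(3)[OF lp u] in simp)
  then show "dim (tangent_space M p) = CARD('m)"
    by (simp add: p tangent_space_local_param[OF lp u] dim_UNIV)
qed

lemma smooth_map_on_ident: "smooth_map_on T M (\<lambda>q. q)"
  by (auto simp: smooth_map_on_def local_param_def o_def)

text \<open>In a chart ball \<open>F\<close> has zero derivative along every segment from the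
  centre; the resulting local constancy spreads by connectedness.\<close>

lemma tderiv_zero_imp_constant:
  fixes M :: "'a::euclidean_space topology" and F :: "'a \<Rightarrow> 'b::real_normed_vector"
  assumes M: "submanifold TYPE('m::finite) M" and F: "mdiff M F"
    and zero: "\<And>w p. p \<in> topspace M \<Longrightarrow> tderiv M w F p = 0"
  shows "F constant_on topspace M"
proof -
  have loc: "\<exists>U. openin M U \<and> p \<in> U \<and> (\<forall>q\<in>U. F q = F p)" if pM: "p \<in> topspace M" for p
  proof -
    from M pM obtain V and x :: "real^'m \<Rightarrow> 'a" where lp: "local_param M V x" and "p \<in> x ` V"
      unfolding submanifold_def by blast
    then obtain u where u: "u \<in> V" and p: "p = x u"
      by blast
    obtain r where r: "r > 0" "ball u r \<subseteq> V"
      using local_paramD(1)[OF lp] u open_contains_ball by blast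
    have const: "F (x z) = F (x u)" if z: "z \<in> ball u r" for z
    proof -
      define h where "h t = F (x (u + t *\<^sub>R (z - u)))" for t :: real
      have "(h has_vector_derivative 0) (at t)" if t: "t \<in> {0..1}" for t
      proof -
        let ?y = "u + t *\<^sub>R (z - u)" and ?v = "frechet_derivative x (at (u + t *\<^sub>R (z - u))) (z - u)"
        have "\<bar>t\<bar> * norm (z - u) \<le> 1 * norm (z - u)"
          using t by (intro mult_right_mono) auto
        then have "?y \<in> ball u r"
          using z by (simp add: dist_norm norm_minus_commute)
        then have y: "?y \<in> V"
          using r by blast
        have cu: "curve_at M (x ?y) ?v (\<lambda>s. x (?y + s *\<^sub>R (z - u)))"
          by (rule local_param_curve_at[OF lp y])
        have xy: "x ?y \<in> topspace M"
          using local_paramD(5)[OF lp] y by blast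
        then obtain D where D: "has_mderiv M F (x ?y) D"
          using F by (auto simp: mdiff_def)
        have v: "?v \<in> tangent_space M (x ?y)"
          using cu by (auto simp: tangent_space_def)
        have "D ?v = tderiv M ?v F (x ?y)"
          unfolding tderiv_def tan_ext_def
          by (simp add: orth_proj_self[OF tangent_space_submanifold(1)[OF M xy] v] dir_deriv_eq[OF D v])
        then have "D ?v = 0"
          using zero[OF xy] by simp
        moreover have "((\<lambda>s. F (x (?y + s *\<^sub>R (z - u)))) has_vector_derivative D ?v) (at 0)"
          using D cu unfolding has_mderiv_def by blast
        ultimately have "((\<lambda>s. F (x (?y + s *\<^sub>R (z - u)))) has_vector_derivative 0) (at 0)"
          by simp
        \<comment> \<open>The base point is written as \<open>t - t\<close> to fit the chain rule
          for the shift \<open>s \<mapsto> s - t\<close>, which carries the derivative of the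
          restarted curve at 0 to that of \<open>h\<close> at \<open>t\<close>.\<close>
        then have *: "((\<lambda>s. F (x (?y + s *\<^sub>R (z - u)))) has_vector_derivative 0) (at (t - t))"
          by simp
        have "((\<lambda>s. s - t) has_vector_derivative 1) (at t)"
          by (auto intro!: derivative_eq_intros)
        from vector_diff_chain_at[OF this *] show ?thesis
          by (simp add: h_def[abs_def] o_def algebra_simps)
      qed
      note deriv = this
      have "h 1 = h 0"
      proof (rule has_vector_derivative_zero_constant[OF convex_real_interval(5)[of 0 1], of h])
        show "(h has_vector_derivative 0) (at t within {0..1})" if "t \<in> {0..1}" for t
          by (rule has_vector_derivative_at_within[OF deriv[OF that]])
        show "h 1 = h 0" if "\<And>t. t \<in> {0..1} \<Longrightarrow> h t = c" for c
          using that[of 1] that[of 0] by simp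
      qed
      then show ?thesis
        by (simp add: h_def)
    qed
    have op: "openin M (x ` ball u r)"
    proof -
      have "open_map (top_of_set V) (subtopology M (x ` V)) x"
        using lp unfolding local_param_def by (intro homeomorphic_imp_open_map) simp
      moreover have "openin (top_of_set V) (ball u r)"
        using r(2) local_paramD(1)[OF lp] by (simp add: openin_open_eq)
      ultimately have "openin (subtopology M (x ` V)) (x ` ball u r)"
        by (simp add: open_map_def)
      then show ?thesis
        by (rule openin_trans_full[OF _ local_paramD(4)[OF lp]])
    qed
    show ?thesis
    proof (intro exI conjI ballI)
      show "openin M (x ` ball u r)" by (rule op)
      show "p \<in> x ` ball u r"
        unfolding p using r(1) by (intro imageI) simp
      show "F q = F p" if "q \<in> x ` ball u r" for q
        using that const unfolding p by (elim imageE) simp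
    qed
  qed
  show ?thesis
  proof (cases "topspace M = {}")
    case True
    then show ?thesis by (simp add: constant_on_def)
  next
    case False
    then obtain p where p: "p \<in> topspace M" by blast
    let ?A = "{q \<in> topspace M. F q = F p}" and ?B = "{q \<in> topspace M. F q \<noteq> F p}"
    \<comment> \<open>By local constancy any condition on the value of \<open>F\<close> defines an
      open set, so a level set and its complement are both open.\<close>
    have op: "openin M {q \<in> topspace M. Q (F q)}" for Q
    proof (subst openin_subopen, intro ballI)
      fix q assume q: "q \<in> {q \<in> topspace M. Q (F q)}"
      then obtain U where U: "openin M U" "q \<in> U" "\<forall>r\<in>U. F r = F q"
        using loc[of q] by blast
      have "Q (F r)" if "r \<in> U" for r
        using q bspec[OF U(3) that] by simp
      then show "\<exists>T. openin M T \<and> q \<in> T \<and> T \<subseteq> {q \<in> topspace M. Q (F q)}"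
        using U(1,2) openin_subset[OF U(1)] by blast
    qed
    have "openin M ?A" by (rule op)
    moreover have "openin M ?B" by (rule op)
    moreover have "connected_space M"
      using M by (simp add: submanifold_def)
    moreover have "?A \<noteq> {}" using p by blast
    ultimately have "?B = {}"
      unfolding connected_space_def by blast
    then show ?thesis
      unfolding constant_on_def by blast
  qed
qed

section \<open>Tangential derivatives and the Laplacian\<close>

definition mdiff2 :: "'a::euclidean_space topology \<Rightarrow> ('a \<Rightarrow> 'b::real_normed_vector) \<Rightarrow> bool" where
  "mdiff2 M F \<longleftrightarrow> mdiff M F \<and> (\<forall>w. mdiff M (tderiv M w F))"

text \<open>The operator \<open>L\<close> of the overview; by \<open>laplacian_eq_lap\<close> it is
  minus \<open>laplacian\<close>.\<close>

definition lap :: "'a::euclidean_space topology \<Rightarrow> ('a \<Rightarrow> 'b::real_normed_vector) \<Rightarrow> 'a \<Rightarrow> 'b" where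
  "lap M F p = (\<Sum>b\<in>Basis. tderiv M b (tderiv M b F) p)"

lemma mdiff_const: "mdiff M (\<lambda>q. c)"
  using has_mderiv_const by (auto simp: mdiff_def)

lemma mdiff_ident: "mdiff M (\<lambda>q. q)"
  using has_mderiv_ident by (auto simp: mdiff_def)

lemma mdiff_add: "mdiff M F \<Longrightarrow> mdiff M G \<Longrightarrow> mdiff M (\<lambda>q. F q + G q)"
  unfolding mdiff_def using has_mderiv_add by blast

lemma mdiff_bilinear:
  "bounded_bilinear h \<Longrightarrow> mdiff M F \<Longrightarrow> mdiff M G \<Longrightarrow> mdiff M (\<lambda>q. h (F q) (G q))"
  unfolding mdiff_def using has_mderiv_bilinear by blast

lemma mdiff2D: "mdiff2 M F \<Longrightarrow> mdiff M F" "mdiff2 M F \<Longrightarrow> mdiff M (tderiv M w F)"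
  by (auto simp: mdiff2_def)

text \<open>Collects what the charts deliver; inside the locale the calculus works with projections
  alone.\<close>

locale tangent_calculus =
  fixes M :: "'a::euclidean_space topology" and m :: nat
  assumes subspace_tangent: "p \<in> topspace M \<Longrightarrow> subspace (tangent_space M p)"
    and dim_tangent: "p \<in> topspace M \<Longrightarrow> dim (tangent_space M p) = m"
    and mdiff_tan_ext: "mdiff M (tan_ext M w)"
begin

lemma tan_ext_in: "p \<in> topspace M \<Longrightarrow> tan_ext M w p \<in> tangent_space M p"
  unfolding tan_ext_def by (rule orth_proj_in[OF subspace_tangent])

lemma tan_ext_self: "p \<in> topspace M \<Longrightarrow> w \<in> tangent_space M p \<Longrightarrow> tan_ext M w p = w"
  unfolding tan_ext_def by (rule orth_proj_self[OF subspace_tangent])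

lemma linear_tan_ext: "p \<in> topspace M \<Longrightarrow> linear (\<lambda>w. tan_ext M w p)"
  unfolding tan_ext_def by (rule linear_orth_proj[OF subspace_tangent])

lemma tan_ext_inner: "p \<in> topspace M \<Longrightarrow> u \<in> tangent_space M p \<Longrightarrow> tan_ext M w p \<bullet> u = w \<bullet> u"
  unfolding tan_ext_def by (rule orth_proj_inner[OF subspace_tangent])

lemma sum_tan_ext_inner: "p \<in> topspace M \<Longrightarrow> (\<Sum>b\<in>Basis. tan_ext M b p \<bullet> b) = real m"
  unfolding tan_ext_def using sum_orth_proj_inner[OF subspace_tangent] dim_tangent by simp

lemma tderiv_eq:
  "has_mderiv M F p D \<Longrightarrow> p \<in> topspace M \<Longrightarrow> tderiv M w F p = D (tan_ext M w p)"
  unfolding tderiv_def by (rule dir_deriv_eq[OF _ tan_ext_in])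

lemma tderiv_tan_ext: "p \<in> topspace M \<Longrightarrow> tderiv M (tan_ext M w p) F p = tderiv M w F p"
  unfolding tderiv_def by (simp add: tan_ext_self tan_ext_in)

lemma dir_deriv_tangent:
  "p \<in> topspace M \<Longrightarrow> v \<in> tangent_space M p \<Longrightarrow> dir_deriv M F p v = tderiv M v F p"
  unfolding tderiv_def by (simp add: tan_ext_self)

lemma tderiv_cong:
  assumes "mdiff M F" "\<And>q. q \<in> topspace M \<Longrightarrow> F q = G q" "p \<in> topspace M"
  shows "tderiv M w F p = tderiv M w G p"
proof -
  obtain D where D: "has_mderiv M F p D"
    using assms by (auto simp: mdiff_def)
  then have "has_mderiv M G p D"
    using assms(2) by (rule has_mderiv_cong)
  with D show ?thesis
    using assms(3) by (simp add: tderiv_eq)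
qed

lemma tderiv_const: "p \<in> topspace M \<Longrightarrow> tderiv M w (\<lambda>q. c) p = 0"
  using tderiv_eq[OF has_mderiv_const] by blast

lemma tderiv_ident: "p \<in> topspace M \<Longrightarrow> tderiv M w (\<lambda>q. q) p = tan_ext M w p"
  using tderiv_eq[OF has_mderiv_ident] by blast

lemma tderiv_add:
  assumes "mdiff M F" "mdiff M G" "p \<in> topspace M"
  shows "tderiv M w (\<lambda>q. F q + G q) p = tderiv M w F p + tderiv M w G p"
proof -
  obtain D where "has_mderiv M F p D"
    using assms by (auto simp: mdiff_def)
  moreover obtain D' where "has_mderiv M G p D'"
    using assms by (auto simp: mdiff_def)
  ultimately show ?thesis
    using assms(3) by (simp add: tderiv_eq tderiv_eq[OF has_mderiv_add])
qed

lemma tderiv_bilinear: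
  assumes "bounded_bilinear h" "mdiff M F" "mdiff M G" "p \<in> topspace M"
  shows "tderiv M w (\<lambda>q. h (F q) (G q)) p = h (F p) (tderiv M w G p) + h (tderiv M w F p) (G p)"
proof -
  obtain D where "has_mderiv M F p D"
    using assms by (auto simp: mdiff_def)
  moreover obtain D' where "has_mderiv M G p D'"
    using assms by (auto simp: mdiff_def)
  ultimately show ?thesis
    using assms(4) by (simp add: tderiv_eq tderiv_eq[OF has_mderiv_bilinear[OF assms(1)]])
qed

lemmas tderiv_inner = tderiv_bilinear[OF bounded_bilinear_inner]
lemmas tderiv_scaleR = tderiv_bilinear[OF bounded_bilinear_scaleR]

lemma linear_tderiv:
  assumes "mdiff M F" "p \<in> topspace M"
  shows "linear (\<lambda>w. tderiv M w F p)"
proof -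
  obtain D where D: "has_mderiv M F p D"
    using assms by (auto simp: mdiff_def)
  then have "linear D"
    by (simp add: has_mderiv_def linear_conv_bounded_linear)
  then have "linear (\<lambda>w. D (tan_ext M w p))"
    using linear_compose[OF linear_tan_ext[OF assms(2)], of D] by (simp add: o_def)
  then show ?thesis
    by (simp add: tderiv_eq[OF D assms(2)])
qed

text \<open>Linearity of the inner derivative in its direction is known only at points of
  \<open>M\<close>, so it passes under the outer derivative through
  \<open>tderiv_cong\<close>.\<close>

lemma linear_tderiv2:
  assumes "mdiff2 M F" "p \<in> topspace M"
  shows "linear (\<lambda>w. tderiv M v (tderiv M w F) p)"
proof (rule linearI)
  note F = mdiff2D[OF assms(1)]
  note lin = linear_tderiv[OF F(1)]
  show "tderiv M v (tderiv M (w + w') F) p = tderiv M v (tderiv M w F) p + tderiv M v (tderiv M w' F) p" for w w'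
    using tderiv_cong[OF F(2)[of "w + w'"] _ assms(2), of "\<lambda>q. tderiv M w F q + tderiv M w' F q" v]
    by (simp add: linear_add[OF lin] tderiv_add F assms(2))
  show "tderiv M v (tderiv M (c *\<^sub>R w) F) p = c *\<^sub>R tderiv M v (tderiv M w F) p" for c w
    using tderiv_cong[OF F(2)[of "c *\<^sub>R w"] _ assms(2), of "\<lambda>q. c *\<^sub>R tderiv M w F q" v]
    by (simp add: linear_scale[OF lin] tderiv_scaleR[OF mdiff_const F(2) assms(2)] tderiv_const assms(2))
qed

lemma mdiff2_cong:
  assumes "mdiff2 M F" "\<And>q. q \<in> topspace M \<Longrightarrow> F q = G q"
  shows "mdiff2 M G"
  unfolding mdiff2_def
proof (intro conjI allI)
  show "mdiff M G"
    by (rule mdiff_cong[OF mdiff2D(1)[OF assms(1)] assms(2)])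
  show "mdiff M (tderiv M w G)" for w
    by (rule mdiff_cong[OF mdiff2D(2)[OF assms(1)]]) (rule tderiv_cong[OF mdiff2D(1)[OF assms(1)] assms(2)])
qed

lemma mdiff2_const: "mdiff2 M (\<lambda>q. c)"
  unfolding mdiff2_def by (auto intro: mdiff_const mdiff_cong[OF mdiff_const[of M 0]] simp: tderiv_const)

lemma mdiff2_ident: "mdiff2 M (\<lambda>q. q)"
  unfolding mdiff2_def by (auto intro: mdiff_ident mdiff_cong[OF mdiff_tan_ext] simp: tderiv_ident)

lemma mdiff2_add:
  assumes "mdiff2 M F" "mdiff2 M G"
  shows "mdiff2 M (\<lambda>q. F q + G q)"
  unfolding mdiff2_def
proof (intro conjI allI)
  note D = mdiff2D[OF assms(1)] mdiff2D[OF assms(2)]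
  show "mdiff M (\<lambda>q. F q + G q)"
    by (rule mdiff_add[OF D(1,3)])
  show "mdiff M (tderiv M w (\<lambda>q. F q + G q))" for w
    by (rule mdiff_cong[OF mdiff_add[OF D(2) D(4)]]) (rule tderiv_add[OF D(1,3), symmetric])
qed

lemma mdiff2_bilinear:
  assumes h: "bounded_bilinear h" and "mdiff2 M F" "mdiff2 M G"
  shows "mdiff2 M (\<lambda>q. h (F q) (G q))"
  unfolding mdiff2_def
proof (intro conjI allI)
  note D = mdiff2D[OF assms(2)] mdiff2D[OF assms(3)]
  show "mdiff M (\<lambda>q. h (F q) (G q))"
    by (rule mdiff_bilinear[OF h D(1,3)])
  show "mdiff M (tderiv M w (\<lambda>q. h (F q) (G q)))" for w
    by (rule mdiff_cong[OF mdiff_add[OF mdiff_bilinear[OF h D(1) D(4)] mdiff_bilinear[OF h D(2) D(3)]]])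
      (rule tderiv_bilinear[OF h D(1,3), symmetric])
qed

lemmas mdiff2_inner = mdiff2_bilinear[OF bounded_bilinear_inner]
lemmas mdiff2_scaleR = mdiff2_bilinear[OF bounded_bilinear_scaleR]

lemma lap_cong:
  assumes "mdiff2 M F" "\<And>q. q \<in> topspace M \<Longrightarrow> F q = G q" "p \<in> topspace M"
  shows "lap M F p = lap M G p"
  unfolding lap_def
  using tderiv_cong[OF mdiff2D(2)[OF assms(1)] tderiv_cong[OF mdiff2D(1)[OF assms(1)] assms(2)] assms(3)]
  by simp

lemma lap_const: "p \<in> topspace M \<Longrightarrow> lap M (\<lambda>q. c) p = 0"
  unfolding lap_def
  by (simp add: tderiv_cong[OF mdiff2D(2)[OF mdiff2_const] tderiv_const] tderiv_const)

lemma lap_add: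
  assumes "mdiff2 M F" "mdiff2 M G" "p \<in> topspace M"
  shows "lap M (\<lambda>q. F q + G q) p = lap M F p + lap M G p"
proof -
  note D = mdiff2D[OF assms(1)] mdiff2D[OF assms(2)]
  have "tderiv M b (tderiv M b (\<lambda>q. F q + G q)) p
      = tderiv M b (tderiv M b F) p + tderiv M b (tderiv M b G) p" for b
    using tderiv_cong[OF mdiff2D(2)[OF mdiff2_add[OF assms(1,2)]] tderiv_add[OF D(1,3)] assms(3)]
    by (simp add: tderiv_add[OF D(2,4) assms(3)])
  then show ?thesis
    by (simp add: lap_def sum.distrib)
qed

lemma lap_bilinear:
  assumes h: "bounded_bilinear h" and "mdiff2 M F" "mdiff2 M G" "p \<in> topspace M"
  shows "lap M (\<lambda>q. h (F q) (G q)) p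
    = h (F p) (lap M G p) + 2 *\<^sub>R (\<Sum>b\<in>Basis. h (tderiv M b F p) (tderiv M b G p)) + h (lap M F p) (G p)"
proof -
  note D = mdiff2D[OF assms(2)] mdiff2D[OF assms(3)]
  have "tderiv M b (tderiv M b (\<lambda>q. h (F q) (G q))) p = h (F p) (tderiv M b (tderiv M b G) p)
      + 2 *\<^sub>R h (tderiv M b F p) (tderiv M b G p) + h (tderiv M b (tderiv M b F) p) (G p)" for b
    using tderiv_cong[OF mdiff2D(2)[OF mdiff2_bilinear[OF assms(1-3)]] tderiv_bilinear[OF h D(1,3)] assms(4)]
    by (simp add: tderiv_add[OF mdiff_bilinear[OF h D(1) D(4)] mdiff_bilinear[OF h D(2) D(3)] assms(4)]
        tderiv_bilinear[OF h D(1) D(4) assms(4)] tderiv_bilinear[OF h D(2) D(3) assms(4)] scaleR_2)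
  then show ?thesis
    by (simp add: lap_def sum.distrib bounded_bilinear.sum_right[OF h] bounded_bilinear.sum_left[OF h]
        scaleR_sum_right)
qed

lemmas lap_inner = lap_bilinear[OF bounded_bilinear_inner, unfolded real_scaleR_def]
lemmas lap_scaleR = lap_bilinear[OF bounded_bilinear_scaleR]

lemma lap_cmult:
  assumes "mdiff2 M F" "p \<in> topspace M"
  shows "lap M (\<lambda>q. c *\<^sub>R F q) p = c *\<^sub>R lap M F p"
  by (simp add: lap_scaleR[OF mdiff2_const assms] tderiv_const lap_const assms(2))

text \<open>Differentiate \<open>tan_ext M w q \<bullet> tan_ext M z q = tan_ext M w q \<bullet>
  z\<close>, valid because the projection is symmetric and idempotent. At \<open>p\<close> the field
  of \<open>z\<close> has value \<open>z\<close>, so one term cancels.\<close>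

lemma tan_ext_inner_tderiv:
  assumes p: "p \<in> topspace M" and z: "z \<in> tangent_space M p"
  shows "tan_ext M w p \<bullet> tderiv M v (tan_ext M z) p = 0"
proof -
  have "tderiv M v (\<lambda>q. tan_ext M w q \<bullet> tan_ext M z q) p = tderiv M v (\<lambda>q. tan_ext M w q \<bullet> z) p"
  proof (rule tderiv_cong[OF mdiff_bilinear[OF bounded_bilinear_inner mdiff_tan_ext mdiff_tan_ext] _ p])
    fix q assume "q \<in> topspace M"
    then show "tan_ext M w q \<bullet> tan_ext M z q = tan_ext M w q \<bullet> z"
      using tan_ext_inner[OF _ tan_ext_in, of q z w] by (simp add: inner_commute)
  qed
  then show ?thesis
    by (simp add: tderiv_inner mdiff_tan_ext mdiff_const p tderiv_const tan_ext_self[OF p z])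
qed

text \<open>The extensions \<open>tan_ext M w\<close> are parallel at the point, so the correction
  terms in \<open>hessian\<close>, \<open>second_fund_form\<close> and
  \<open>second_cov_deriv\<close> disappear.\<close>

lemma cov_deriv_tan_ext:
  assumes p: "p \<in> topspace M" and "v \<in> tangent_space M p" "w \<in> tangent_space M p"
  shows "cov_deriv M M (tan_ext M w) p v = 0"
  unfolding cov_deriv_def dir_deriv_tangent[OF assms(1,2)]
proof (rule orth_proj_eqI[OF subspace_tangent[OF p]])
  show "0 \<in> tangent_space M p"
    by (rule subspace_0[OF subspace_tangent[OF p]])
  fix u assume "u \<in> tangent_space M p"
  then show "(tderiv M v (tan_ext M w) p - 0) \<bullet> u = 0"
    using tan_ext_inner_tderiv[OF p assms(3), of u v] by (simp add: tan_ext_self p inner_commute)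
qed

lemma sum_bilinear_eq_0:
  fixes B :: "'a \<Rightarrow> 'a \<Rightarrow> real"
  assumes p: "p \<in> topspace M" and "\<And>v w. v \<in> tangent_space M p \<Longrightarrow> w \<in> tangent_space M p \<Longrightarrow> B v w = 0"
    and "\<And>w. linear (\<lambda>v. B v w)" "\<And>v. linear (B v)"
  shows "(\<Sum>b\<in>Basis. B (tan_ext M b p) b) = 0"
  using trace_over_eq[OF subspace_tangent[OF p], of "\<lambda>_ _. 0" B] assms
  by (simp add: trace_over_def tan_ext_def)

lemma dir_deriv_0: "mdiff M F \<Longrightarrow> p \<in> topspace M \<Longrightarrow> dir_deriv M F p 0 = 0"
  by (simp add: dir_deriv_tangent[OF _ subspace_0[OF subspace_tangent]] linear_0[OF linear_tderiv])

text \<open>With the correction term gone, the Hessian on tangent vectors is an iterated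
  \<open>tderiv\<close>, which is bilinear in all ambient vectors. After
  \<open>trace_over_eq\<close>, the projection of the outer direction is absorbed by
  \<open>tderiv\<close> itself.\<close>

lemma laplacian_eq_lap:
  assumes F: "mdiff2 M F" and p: "p \<in> topspace M"
  shows "laplacian M F p = - lap M F p"
proof -
  have *: "(\<lambda>q. dir_deriv M F q (tan_ext M w q)) = tderiv M w F" for w
    by (simp add: tderiv_def fun_eq_iff)
  have "trace_over (tangent_space M p) (hessian M F p)
      = (\<Sum>b\<in>Basis. tderiv M (orth_proj (tangent_space M p) b) (tderiv M b F) p)"
  proof (rule trace_over_eq[OF subspace_tangent[OF p]])
    show "hessian M F p v w = tderiv M v (tderiv M w F) p"
      if "v \<in> tangent_space M p" "w \<in> tangent_space M p" for v w
      unfolding hessian_def *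
      by (simp add: cov_deriv_tan_ext p that dir_deriv_0 mdiff2D[OF F] dir_deriv_tangent)
    show "linear (\<lambda>v. tderiv M v (tderiv M w F) p)" for w
      by (rule linear_tderiv[OF mdiff2D(2)[OF F] p])
    show "linear (\<lambda>w. tderiv M v (tderiv M w F) p)" for v
      by (rule linear_tderiv2[OF F p])
  qed
  then show ?thesis
    by (simp add: laplacian_def lap_def tderiv_tan_ext[OF p, unfolded tan_ext_def])
qed

lemma tderiv_tderiv_ident:
  "p \<in> topspace M \<Longrightarrow> tderiv M v (tderiv M w (\<lambda>q. q)) p = tderiv M v (tan_ext M w) p"
  using tderiv_cong[OF mdiff_tan_ext tderiv_ident[symmetric]] by simp

text \<open>The second fundamental form takes normal values. A single summand for an ambient basis
  vector need not be normal; the sum is, because as a trace it depends on tangent arguments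
  only.\<close>

lemma lap_ident_normal:
  assumes p: "p \<in> topspace M" and z: "z \<in> tangent_space M p"
  shows "lap M (\<lambda>q. q) p \<bullet> z = 0"
proof -
  have "(\<Sum>b\<in>Basis. tderiv M (tan_ext M b p) (tderiv M b (\<lambda>q. q)) p \<bullet> z) = 0"
  proof (rule sum_bilinear_eq_0[OF p])
    show "tderiv M v (tderiv M w (\<lambda>q. q)) p \<bullet> z = 0" if "w \<in> tangent_space M p" for v w
      using tan_ext_inner_tderiv[OF p that, of z v]
      by (simp add: tderiv_tderiv_ident p tan_ext_self z inner_commute)
    show "linear (\<lambda>v. tderiv M v (tderiv M w (\<lambda>q. q)) p \<bullet> z)" for w
      using linear_compose[OF linear_tderiv[OF mdiff2D(2)[OF mdiff2_ident] p]
          bounded_linear.linear[OF bounded_linear_inner_left[of z]]] by (simp add: o_def)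
    show "linear (\<lambda>w. tderiv M v (tderiv M w (\<lambda>q. q)) p \<bullet> z)" for v
      using linear_compose[OF linear_tderiv2[OF mdiff2_ident p]
          bounded_linear.linear[OF bounded_linear_inner_left[of z]]] by (simp add: o_def)
  qed
  then show ?thesis
    by (simp add: lap_def inner_sum_left tderiv_tan_ext p)
qed

end

section \<open>Submanifolds of the unit sphere\<close>

lemma has_mderiv_of_has_derivative:
  assumes "(F has_derivative F') (at p)"
  shows "has_mderiv M F p F'"
  unfolding has_mderiv_def
proof (intro conjI allI impI)
  show "bounded_linear F'"
    using assms by (rule has_derivative_bounded_linear)
  fix v \<gamma> assume "curve_at M p v \<gamma>"
  then have \<gamma>: "\<gamma> 0 = p" "(\<gamma> has_vector_derivative v) (at 0)"
    by (auto simp: curve_at_def)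
  have "((F \<circ> \<gamma>) has_vector_derivative F' v) (at 0)"
    by (rule vector_derivative_diff_chain_within[OF \<gamma>(2) has_derivative_at_withinI])
      (simp add: \<gamma>(1) assms)
  then show "((\<lambda>t. F (\<gamma> t)) has_vector_derivative F' v) (at 0)"
    by (simp add: o_def)
qed

lemma tangent_space_sphere:
  fixes p :: "'a::euclidean_space"
  assumes p: "p \<in> sphere 0 1"
  shows "tangent_space unit_sphere p = {v. v \<bullet> p = 0}"
proof (intro set_eqI iffI)
  fix v assume "v \<in> tangent_space unit_sphere p"
  then obtain \<gamma> where c: "curve_at unit_sphere p v \<gamma>"
    by (auto simp: tangent_space_def)
  have "has_mderiv unit_sphere (\<lambda>q::'a. q \<bullet> q) p (\<lambda>v. p \<bullet> v + v \<bullet> p)"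
    by (rule has_mderiv_bilinear[OF bounded_bilinear_inner has_mderiv_ident has_mderiv_ident])
  moreover have "has_mderiv unit_sphere (\<lambda>q::'a. q \<bullet> q) p (\<lambda>v. 0)"
    by (rule has_mderiv_cong[OF has_mderiv_const[of _ 1]]) (simp add: dot_square_norm)
  ultimately have "p \<bullet> v + v \<bullet> p = 0"
    using c unfolding has_mderiv_def by (blast intro: vector_derivative_unique_at)
  then show "v \<in> {v. v \<bullet> p = 0}"
    by (simp add: inner_commute)
next
  fix v assume "v \<in> {v. v \<bullet> p = 0}"
  then have v: "v \<bullet> p = 0" "p \<bullet> v = 0"
    by (simp_all add: inner_commute)
  \<comment> \<open>The straight line through \<open>p\<close> with velocity \<open>v\<close>,
    pushed radially onto the sphere. The normalising factor is even in \<open>t\<close>, so it does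
    not change the velocity at 0.\<close>
  define \<gamma> where "\<gamma> t = inverse (sqrt (1 + t\<^sup>2 * (v \<bullet> v))) *\<^sub>R (p + t *\<^sub>R v)" for t
  have pos: "1 + t\<^sup>2 * (v \<bullet> v) > 0" for t
    by (intro add_pos_nonneg mult_nonneg_nonneg) auto
  have pp: "p \<bullet> p = 1"
    using p by (simp add: dot_square_norm)
  have n: "\<gamma> t \<in> sphere 0 1" for t
  proof -
    have "(p + t *\<^sub>R v) \<bullet> (p + t *\<^sub>R v) = 1 + t\<^sup>2 * (v \<bullet> v)"
      by (simp add: inner_add_left inner_add_right v pp power2_eq_square)
    then have "norm (p + t *\<^sub>R v) = sqrt (1 + t\<^sup>2 * (v \<bullet> v))"
      by (simp add: norm_eq_sqrt_inner)
    then show ?thesis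
      using pos[of t] by (simp add: \<gamma>_def)
  qed
  have "continuous_on UNIV \<gamma>"
    unfolding \<gamma>_def using pos by (intro continuous_intros) (auto simp: less_imp_neq[symmetric])
  then have "continuous_map (top_of_set {-1<..<1}) unit_sphere \<gamma>"
    using n by (auto intro: continuous_on_subset)
  moreover have "(\<gamma> has_vector_derivative v) (at 0)"
    unfolding \<gamma>_def by (auto intro!: derivative_eq_intros)
  ultimately have "curve_at unit_sphere p v \<gamma>"
    unfolding curve_at_def by (auto simp: \<gamma>_def intro!: exI[of _ 1])
  then show "v \<in> tangent_space unit_sphere p"
    by (auto simp: tangent_space_def)
qed

lemma orth_proj_sphere:
  fixes p :: "'a::euclidean_space"
  assumes p: "p \<in> sphere 0 1"
  shows "orth_proj (tangent_space unit_sphere p) w = w - (w \<bullet> p) *\<^sub>R p"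
proof -
  have pp: "p \<bullet> p = 1"
    using p by (simp add: dot_square_norm)
  have S: "subspace {v. v \<bullet> p = 0}"
    using subspace_hyperplane[of p] by (simp add: inner_commute)
  show ?thesis
    unfolding tangent_space_sphere[OF p]
  proof (rule orth_proj_eqI[OF S])
    show "w - (w \<bullet> p) *\<^sub>R p \<in> {v. v \<bullet> p = 0}"
      by (simp add: inner_diff_left pp)
    show "(w - (w - (w \<bullet> p) *\<^sub>R p)) \<bullet> u = 0" if "u \<in> {v. v \<bullet> p = 0}" for u
      using that inner_commute[of u p] by simp
  qed
qed

text \<open>Constant curvature 1. On the sphere the extended fields have the closed form
  \<open>w - (w \<bullet> q) *\<^sub>R q\<close>, so each covariant derivative is an ambient
  derivative followed by a projection.\<close>

lemma riemann_curv_sphere: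
  fixes p :: "'a::euclidean_space"
  assumes p: "p \<in> sphere 0 1" and x: "x \<bullet> p = 0" and y: "y \<bullet> p = 0" and z: "z \<bullet> p = 0"
  shows "riemann_curv unit_sphere p x y z = (y \<bullet> z) *\<^sub>R x - (x \<bullet> z) *\<^sub>R y"
proof -
  let ?S = "unit_sphere :: 'a topology"
  have ext: "tan_ext ?S w q = w - (w \<bullet> q) *\<^sub>R q" if "q \<in> sphere 0 1" for w q
    unfolding tan_ext_def by (rule orth_proj_sphere[OF that])
  have extp: "tan_ext ?S x p = x" "tan_ext ?S y p = y"
    using x y by (simp_all add: ext[OF p])
  have mext: "has_mderiv ?S (tan_ext ?S w) q (\<lambda>v. - ((w \<bullet> v) *\<^sub>R q) - (w \<bullet> q) *\<^sub>R v)" for w q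
  proof (rule has_mderiv_cong[OF has_mderiv_of_has_derivative])
    show "((\<lambda>q. w - (w \<bullet> q) *\<^sub>R q) has_derivative (\<lambda>v. - ((w \<bullet> v) *\<^sub>R q) - (w \<bullet> q) *\<^sub>R v)) (at q)"
      by (auto intro!: derivative_eq_intros)
  qed (simp add: ext)
  have dext: "dir_deriv ?S (tan_ext ?S w) q v = - ((w \<bullet> v) *\<^sub>R q) - (w \<bullet> q) *\<^sub>R v"
    if "q \<in> sphere 0 1" "v \<bullet> q = 0" for w q v
    using dir_deriv_eq[OF mext] that by (simp add: tangent_space_sphere)
  have cov: "cov_deriv ?S ?S (tan_ext ?S w) q v = - ((w \<bullet> q) *\<^sub>R v)"
    if "q \<in> sphere 0 1" "v \<bullet> q = 0" for w q v
    using that unfolding cov_deriv_def dext[OF that] orth_proj_sphere[OF that(1)]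
    by (simp add: inner_diff_left dot_square_norm)
  \<comment> \<open>Both \<open>w\<close> and \<open>z\<close> are orthogonal to \<open>p\<close>,
    so at \<open>p\<close> only the derivative of the factor \<open>z \<bullet> q\<close>
    survives.\<close>
  have cov2: "cov_deriv ?S ?S (\<lambda>q. cov_deriv ?S ?S (tan_ext ?S z) q (tan_ext ?S w q)) p v = - ((z \<bullet> v) *\<^sub>R w)"
    if w: "w \<bullet> p = 0" and v: "v \<bullet> p = 0" for w v
  proof -
    have "has_mderiv ?S (\<lambda>q. cov_deriv ?S ?S (tan_ext ?S z) q (tan_ext ?S w q)) p (\<lambda>v. - ((z \<bullet> v) *\<^sub>R w))"
    proof (rule has_mderiv_cong[OF has_mderiv_of_has_derivative])
      show "((\<lambda>q. - ((z \<bullet> q) *\<^sub>R (w - (w \<bullet> q) *\<^sub>R q))) has_derivative (\<lambda>v. - ((z \<bullet> v) *\<^sub>R w))) (at p)"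
        by (auto intro!: derivative_eq_intros simp: w z)
      fix q :: 'a assume "q \<in> topspace ?S"
      then have q: "q \<in> sphere 0 1" by simp
      then have "q \<bullet> q = 1" by (simp add: dot_square_norm)
      then show "- ((z \<bullet> q) *\<^sub>R (w - (w \<bullet> q) *\<^sub>R q)) = cov_deriv ?S ?S (tan_ext ?S z) q (tan_ext ?S w q)"
        by (simp add: ext[OF q] cov[OF q] inner_diff_left)
    qed
    then have "dir_deriv ?S (\<lambda>q. cov_deriv ?S ?S (tan_ext ?S z) q (tan_ext ?S w q)) p v = - ((z \<bullet> v) *\<^sub>R w)"
      by (rule dir_deriv_eq) (simp add: tangent_space_sphere[OF p] v)
    then show ?thesis
      using w by (simp add: cov_deriv_def orth_proj_sphere[OF p])
  qed
  \<comment> \<open>Both directional derivatives are the same multiple of \<open>p\<close>.\<close>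
  have "lie_bracket ?S (tan_ext ?S x) (tan_ext ?S y) p = 0"
    unfolding lie_bracket_def extp dext[OF p x] dext[OF p y] by (simp add: x y inner_commute[of y x])
  then show ?thesis
    unfolding riemann_curv_def curv_field_def extp cov2[OF y x] cov2[OF x y]
    by (simp add: cov[OF p] inner_commute)
qed

section \<open>Mean curvature and the biharmonic equation expressed through
  \<open>lap\<close>\<close>

locale spherical_calculus = tangent_calculus +
  assumes in_sphere: "topspace M \<subseteq> sphere 0 1" and m_pos: "m > 0"
begin

lemma inner_self: "p \<in> topspace M \<Longrightarrow> p \<bullet> p = 1"
  using in_sphere by (auto simp: dot_square_norm)

lemma tan_ext_inner_self:
  assumes p: "p \<in> topspace M"
  shows "tan_ext M w p \<bullet> p = 0"
proof -
  have "tderiv M w (\<lambda>q. q \<bullet> q) p = tderiv M w (\<lambda>q. 1) p"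
    by (rule tderiv_cong[OF mdiff_bilinear[OF bounded_bilinear_inner mdiff_ident mdiff_ident] inner_self p])
  then show ?thesis
    by (simp add: tderiv_inner mdiff_ident p tderiv_ident tderiv_const inner_commute)
qed

lemma tangent_inner_self: "p \<in> topspace M \<Longrightarrow> v \<in> tangent_space M p \<Longrightarrow> v \<bullet> p = 0"
  using tan_ext_inner_self[of p v] by (simp add: tan_ext_self)

lemma orth_proj_unit_sphere:
  "p \<in> topspace M \<Longrightarrow> orth_proj (tangent_space unit_sphere p) w = w - (w \<bullet> p) *\<^sub>R p"
  using in_sphere by (intro orth_proj_sphere) auto

lemma tderiv_tan_ext_inner_self:
  assumes p: "p \<in> topspace M"
  shows "tderiv M v (tan_ext M w) p \<bullet> p = - (tan_ext M w p \<bullet> tan_ext M v p)"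
proof -
  have "tderiv M v (\<lambda>q. tan_ext M w q \<bullet> q) p = tderiv M v (\<lambda>q. 0) p"
    by (rule tderiv_cong[OF mdiff_bilinear[OF bounded_bilinear_inner mdiff_tan_ext mdiff_ident] tan_ext_inner_self p])
  then show ?thesis
    by (simp add: tderiv_inner mdiff_tan_ext mdiff_ident p tderiv_ident tderiv_const)
qed

text \<open>Beltrami's formula in the sphere. Projecting the second derivative of the inclusion
  removes its component \<open>- (v \<bullet> w)\<close> along \<open>p\<close>; tracing
  \<open>(v \<bullet> w) *\<^sub>R p\<close> gives \<open>m\<close> times \<open>p\<close>.\<close>

lemma mean_curv_vec_eq:
  assumes p: "p \<in> topspace M"
  shows "mean_curv_vec unit_sphere M p = (1 / real m) *\<^sub>R lap M (\<lambda>q. q) p + p"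
proof -
  let ?B = "\<lambda>v w. tderiv M v (tderiv M w (\<lambda>q. q)) p + (v \<bullet> w) *\<^sub>R p"
  have "trace_over (tangent_space M p) (second_fund_form unit_sphere M p)
      = (\<Sum>b\<in>Basis. ?B (orth_proj (tangent_space M p) b) b)"
  proof (rule trace_over_eq[OF subspace_tangent[OF p]])
    show "second_fund_form unit_sphere M p v w = ?B v w"
      if "v \<in> tangent_space M p" "w \<in> tangent_space M p" for v w
      using that p unfolding second_fund_form_def
      by (simp add: cov_deriv_tan_ext cov_deriv_def[of unit_sphere] orth_proj_unit_sphere dir_deriv_tangent
          tderiv_tan_ext_inner_self tan_ext_self tderiv_tderiv_ident inner_commute[of w v])
    show "linear (\<lambda>v. ?B v w)" for w
      by (intro linear_compose_add linear_tderiv[OF mdiff2D(2)[OF mdiff2_ident] p])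
        (auto intro!: linearI simp: inner_add_left scaleR_add_left)
    show "linear (\<lambda>w. ?B v w)" for v
      by (intro linear_compose_add linear_tderiv2[OF mdiff2_ident p])
        (auto intro!: linearI simp: inner_add_right scaleR_add_left)
  qed
  also have "\<dots> = lap M (\<lambda>q. q) p + (\<Sum>b\<in>Basis. tan_ext M b p \<bullet> b) *\<^sub>R p"
    by (simp add: sum.distrib lap_def tderiv_tan_ext[OF p, unfolded tan_ext_def] tan_ext_def scaleR_sum_left)
  also have "\<dots> = lap M (\<lambda>q. q) p + real m *\<^sub>R p"
    by (simp add: sum_tan_ext_inner[OF p])
  finally show ?thesis
    using m_pos by (simp add: mean_curv_vec_def dim_tangent[OF p] scaleR_add_right)
qed

lemma mean_curv_vec_normal:
  assumes p: "p \<in> topspace M"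
  shows "mean_curv_vec unit_sphere M p \<bullet> tan_ext M w p = 0"
  using tan_ext_inner_self[OF p, of w] inner_commute[of p "tan_ext M w p"]
  by (simp add: mean_curv_vec_eq p inner_add_left lap_ident_normal tan_ext_in)

text \<open>Apply \<open>lap\<close> to \<open>q \<bullet> q = 1\<close>; the mixed term is twice
  the trace of the projection.\<close>

lemma lap_ident_inner_self:
  assumes p: "p \<in> topspace M"
  shows "lap M (\<lambda>q. q) p \<bullet> p = - real m"
proof -
  have "lap M (\<lambda>q. q \<bullet> q) p = lap M (\<lambda>q. 1) p"
    by (rule lap_cong[OF mdiff2_inner[OF mdiff2_ident mdiff2_ident] inner_self p])
  then have "0 = p \<bullet> lap M (\<lambda>q. q) p + 2 * (\<Sum>b\<in>Basis. tan_ext M b p \<bullet> tan_ext M b p) + lap M (\<lambda>q. q) p \<bullet> p"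
    by (simp add: lap_inner[OF mdiff2_ident mdiff2_ident p] tderiv_ident p lap_const)
  moreover have "(\<Sum>b\<in>Basis. tan_ext M b p \<bullet> tan_ext M b p) = real m"
    using sum_tan_ext_inner[OF p] by (simp add: tan_ext_inner tan_ext_in p inner_commute)
  ultimately show ?thesis
    using inner_commute[of p "lap M (\<lambda>q. q) p"] by simp
qed

lemma mean_curv_vec_inner_self: "p \<in> topspace M \<Longrightarrow> mean_curv_vec unit_sphere M p \<bullet> p = 0"
  using m_pos by (simp add: mean_curv_vec_eq inner_add_left lap_ident_inner_self inner_self)

text \<open>Differentiating \<open>V q \<bullet> q = 0\<close> and using normality to
  \<open>M\<close> shows that the first derivative of \<open>V\<close> stays tangent to the sphere.
  The inner projection is therefore the identity, and only the outer one removes a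
  component.\<close>

lemma rough_laplacian_eq_lap:
  assumes V: "mdiff2 M V" and p: "p \<in> topspace M"
    and V0: "\<And>q. q \<in> topspace M \<Longrightarrow> V q \<bullet> q = 0"
    and V1: "\<And>q w. q \<in> topspace M \<Longrightarrow> V q \<bullet> tan_ext M w q = 0"
  shows "rough_laplacian unit_sphere M V p = - (lap M V p - (lap M V p \<bullet> p) *\<^sub>R p)"
proof -
  note D = mdiff2D[OF V]
  have tV: "tderiv M w V q \<bullet> q = 0" if q: "q \<in> topspace M" for w q
  proof -
    have "tderiv M w (\<lambda>q. V q \<bullet> q) q = tderiv M w (\<lambda>q. 0) q"
      by (rule tderiv_cong[OF mdiff_bilinear[OF bounded_bilinear_inner D(1) mdiff_ident] V0 q])
    then show ?thesis
      by (simp add: tderiv_inner D mdiff_ident q tderiv_ident tderiv_const V1)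
  qed
  have cov: "cov_deriv unit_sphere M V q (tan_ext M w q) = tderiv M w V q" if q: "q \<in> topspace M" for w q
    unfolding cov_deriv_def tderiv_def[symmetric] by (simp add: orth_proj_unit_sphere q tV)
  have mcov: "mdiff M (\<lambda>q. cov_deriv unit_sphere M V q (tan_ext M w q))" for w
    by (rule mdiff_cong[OF D(2)]) (rule cov[symmetric])
  let ?\<Pi> = "\<lambda>y. y - (y \<bullet> p) *\<^sub>R p"
  have lin: "linear ?\<Pi>"
    by (auto intro!: linearI simp: algebra_simps)
  have "trace_over (tangent_space M p) (second_cov_deriv unit_sphere M V p)
      = (\<Sum>b\<in>Basis. ?\<Pi> (tderiv M (orth_proj (tangent_space M p) b) (tderiv M b V) p))"
  proof (rule trace_over_eq[OF subspace_tangent[OF p]])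
    show "second_cov_deriv unit_sphere M V p v w = ?\<Pi> (tderiv M v (tderiv M w V) p)"
      if "v \<in> tangent_space M p" "w \<in> tangent_space M p" for v w
      using that p tderiv_cong[OF mcov cov p, of v w] unfolding second_cov_deriv_def
      by (simp add: cov_deriv_tan_ext cov_deriv_def[of unit_sphere M _ p] dir_deriv_0 D
          orth_proj_unit_sphere dir_deriv_tangent)
    show "linear (\<lambda>v. ?\<Pi> (tderiv M v (tderiv M w V) p))" for w
      using linear_compose[OF linear_tderiv[OF D(2) p] lin] by (simp add: o_def)
    show "linear (\<lambda>w. ?\<Pi> (tderiv M v (tderiv M w V) p))" for v
      using linear_compose[OF linear_tderiv2[OF V p] lin] by (simp add: o_def)
  qed
  also have "\<dots> = ?\<Pi> (lap M V p)"
    unfolding lap_def linear_sum[OF lin] by (simp add: tderiv_tan_ext[OF p, unfolded tan_ext_def])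
  finally show ?thesis
    by (simp add: rough_laplacian_def)
qed

text \<open>For normal \<open>V\<close> the curvature term reduces to
  \<open>- ((v \<bullet> w) *\<^sub>R V)\<close>.\<close>

lemma trace_riemann_curv:
  assumes p: "p \<in> topspace M" and V0: "V \<bullet> p = 0" and V1: "\<And>v. v \<in> tangent_space M p \<Longrightarrow> V \<bullet> v = 0"
  shows "trace_over (tangent_space M p) (\<lambda>v w. riemann_curv unit_sphere p v V w) = - (real m *\<^sub>R V)"
proof -
  have "trace_over (tangent_space M p) (\<lambda>v w. riemann_curv unit_sphere p v V w)
      = (\<Sum>b\<in>Basis. - ((orth_proj (tangent_space M p) b \<bullet> b) *\<^sub>R V))"
  proof (rule trace_over_eq[OF subspace_tangent[OF p]])
    show "riemann_curv unit_sphere p v V w = - ((v \<bullet> w) *\<^sub>R V)"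
      if "v \<in> tangent_space M p" "w \<in> tangent_space M p" for v w
      using that p in_sphere by (subst riemann_curv_sphere) (auto simp: V0 V1 tangent_inner_self)
  qed (auto intro!: linearI simp: inner_add_left inner_add_right scaleR_add_left)
  also have "\<dots> = - ((\<Sum>b\<in>Basis. tan_ext M b p \<bullet> b) *\<^sub>R V)"
    by (simp add: sum_negf scaleR_sum_left tan_ext_def)
  finally show ?thesis
    by (simp add: sum_tan_ext_inner[OF p])
qed

text \<open>The biharmonic equation lives in the tangent space of the sphere, so it fixes
  \<open>lap\<close> of the mean curvature vector up to a multiple of \<open>p\<close>. That
  multiple comes from the vector being orthogonal to \<open>p\<close> and to
  \<open>M\<close>.\<close>

lemma biharmonic_lap_mean_curv_vec:
  assumes bih: "biharmonic unit_sphere M" and H: "mdiff2 M (mean_curv_vec unit_sphere M)"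
    and p: "p \<in> topspace M"
  shows "lap M (mean_curv_vec unit_sphere M) p =
    - (real m *\<^sub>R mean_curv_vec unit_sphere M p)
      + (real m * (mean_curv_vec unit_sphere M p \<bullet> mean_curv_vec unit_sphere M p)) *\<^sub>R p"
proof -
  let ?H = "mean_curv_vec unit_sphere M"
  note D = mdiff2D[OF H]
  have "rough_laplacian unit_sphere M ?H p + trace_over (tangent_space M p) (\<lambda>v w. riemann_curv unit_sphere p v (?H p) w) = 0"
    using bih p by (auto simp: biharmonic_def)
  moreover have "trace_over (tangent_space M p) (\<lambda>v w. riemann_curv unit_sphere p v (?H p) w) = - (real m *\<^sub>R ?H p)"
    by (rule trace_riemann_curv[OF p mean_curv_vec_inner_self[OF p]])
      (metis mean_curv_vec_normal p tan_ext_self)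
  ultimately have eq: "lap M ?H p = - (real m *\<^sub>R ?H p) + (lap M ?H p \<bullet> p) *\<^sub>R p"
    by (simp add: rough_laplacian_eq_lap[OF H p mean_curv_vec_inner_self mean_curv_vec_normal] algebra_simps)
  have "lap M (\<lambda>q. ?H q \<bullet> q) p = lap M (\<lambda>q. 0) p"
    by (rule lap_cong[OF mdiff2_inner[OF H mdiff2_ident] mean_curv_vec_inner_self p])
  then have 1: "?H p \<bullet> lap M (\<lambda>q. q) p + 2 * (\<Sum>b\<in>Basis. tderiv M b ?H p \<bullet> tan_ext M b p) + lap M ?H p \<bullet> p = 0"
    by (simp add: lap_inner[OF H mdiff2_ident p] tderiv_ident p lap_const)
  \<comment> \<open>Normality to \<open>M\<close> evaluates the mixed sum left in the identity
    \<open>1\<close>; together they equate the component of \<open>lap M ?H p\<close> along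
    \<open>p\<close> with \<open>?H p \<bullet> lap M (\<lambda>q. q) p\<close>.\<close>
  have "tderiv M b ?H p \<bullet> tan_ext M b p + ?H p \<bullet> tderiv M b (tderiv M b (\<lambda>q. q)) p = 0" for b
  proof -
    have "tderiv M b (\<lambda>q. ?H q \<bullet> tan_ext M b q) p = tderiv M b (\<lambda>q. 0) p"
      by (rule tderiv_cong[OF mdiff_bilinear[OF bounded_bilinear_inner D(1) mdiff_tan_ext] mean_curv_vec_normal p])
    then show ?thesis
      by (simp add: tderiv_inner[OF D(1) mdiff_tan_ext p] tderiv_const p tderiv_tderiv_ident add.commute)
  qed
  then have 2: "(\<Sum>b\<in>Basis. tderiv M b ?H p \<bullet> tan_ext M b p) + ?H p \<bullet> lap M (\<lambda>q. q) p = 0"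
    by (simp add: lap_def inner_sum_right flip: sum.distrib)
  have "lap M (\<lambda>q. q) p = real m *\<^sub>R ?H p - real m *\<^sub>R p"
    using m_pos by (simp add: mean_curv_vec_eq[OF p] scaleR_add_right)
  then have "?H p \<bullet> lap M (\<lambda>q. q) p = real m * (?H p \<bullet> ?H p)"
    by (simp add: inner_diff_right mean_curv_vec_inner_self p)
  with 1 2 have "lap M ?H p \<bullet> p = real m * (?H p \<bullet> ?H p)"
    by linarith
  with eq show ?thesis by simp
qed

end

context tangent_calculus
begin

lemma mdiff2_sum: "(\<And>i. i \<in> I \<Longrightarrow> mdiff2 M (F i)) \<Longrightarrow> mdiff2 M (\<lambda>q. \<Sum>i\<in>I. F i q)"
  by (induction I rule: infinite_finite_induct) (auto intro: mdiff2_const mdiff2_add)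

lemma lap_sum:
  assumes "\<And>i. i \<in> I \<Longrightarrow> mdiff2 M (F i)" and p: "p \<in> topspace M"
  shows "lap M (\<lambda>q. \<Sum>i\<in>I. F i q) p = (\<Sum>i\<in>I. lap M (F i) p)"
  using assms(1)
  by (induction I rule: infinite_finite_induct) (simp_all add: lap_const lap_add mdiff2_sum p)

end

section \<open>Biharmonic submanifolds of 3-type\<close>

text \<open>The \<open>\<nu> i\<close> are eigenvalues of \<open>lap\<close>, hence the negatives of
  those in \<open>finite_type\<close>.\<close>

locale biharmonic_three_type = spherical_calculus M m for M :: "'a::euclidean_space topology" and m +
  fixes c :: 'a and F :: "nat \<Rightarrow> 'a \<Rightarrow> 'a" and \<nu> :: "nat \<Rightarrow> real"
  assumes biharm: "biharmonic unit_sphere M"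
    and F_mdiff2: "i < 3 \<Longrightarrow> mdiff2 M (F i)"
    and lap_F: "i < 3 \<Longrightarrow> p \<in> topspace M \<Longrightarrow> lap M (F i) p = \<nu> i *\<^sub>R F i p"
    and decomp: "p \<in> topspace M \<Longrightarrow> p = c + (\<Sum>i<3. F i p)"
begin

text \<open>On these combinations \<open>lap\<close> multiplies the coefficients by
  \<open>\<nu>\<close>. For \<open>k > 0\<close> the coefficients \<open>\<nu> i ^ k\<close> give
  the \<open>k\<close>-fold \<open>lap\<close> of the inclusion.\<close>

definition comb :: "(nat \<Rightarrow> real) \<Rightarrow> 'a \<Rightarrow> 'a" where
  "comb a p = (\<Sum>i<3. a i *\<^sub>R F i p)"

abbreviation H :: "'a \<Rightarrow> 'a" where
  "H \<equiv> mean_curv_vec unit_sphere M"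

definition s :: "'a \<Rightarrow> real" where
  "s p = H p \<bullet> H p"

lemma mdiff2_comb: "mdiff2 M (comb a)"
  unfolding comb_def[abs_def] by (intro mdiff2_sum mdiff2_scaleR mdiff2_const F_mdiff2) simp

lemma lap_comb:
  assumes p: "p \<in> topspace M"
  shows "lap M (comb a) p = comb (\<lambda>i. a i * \<nu> i) p"
proof -
  have "lap M (comb a) p = (\<Sum>i<3. lap M (\<lambda>q. a i *\<^sub>R F i q) p)"
    unfolding comb_def[abs_def]
    by (rule lap_sum[OF mdiff2_scaleR[OF mdiff2_const F_mdiff2] p]) simp
  also have "\<dots> = comb (\<lambda>i. a i * \<nu> i) p"
    unfolding comb_def by (intro sum.cong refl) (simp add: lap_cmult F_mdiff2 lap_F p)
  finally show ?thesis .
qed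

lemma comb_add: "comb a p + comb b p = comb (\<lambda>i. a i + b i) p"
  by (simp add: comb_def scaleR_add_left sum.distrib)

lemma comb_cmult: "r *\<^sub>R comb a p = comb (\<lambda>i. r * a i) p"
  by (simp add: comb_def scaleR_sum_right)

lemma comb_cong: "(\<And>i. i < 3 \<Longrightarrow> a i = b i) \<Longrightarrow> comb a p = comb b p"
  by (simp add: comb_def)

lemma decomp_comb: "p \<in> topspace M \<Longrightarrow> c + comb (\<lambda>i. 1) p = p"
  using decomp by (simp add: comb_def)

lemma lap_ident:
  assumes p: "p \<in> topspace M"
  shows "lap M (\<lambda>q. q) p = comb \<nu> p"
  using lap_cong[OF mdiff2_add[OF mdiff2_const mdiff2_comb] decomp_comb p]
  by (simp add: lap_add[OF mdiff2_const mdiff2_comb p] lap_const lap_comb p)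

lemma comb_\<nu>: "p \<in> topspace M \<Longrightarrow> comb \<nu> p = real m *\<^sub>R H p - real m *\<^sub>R p"
  using m_pos by (simp add: mean_curv_vec_eq lap_ident scaleR_add_right)

text \<open>\<open>H\<close> involves second derivatives of the inclusion; its own two derivatives
  come from writing it as a combination of the eigenmaps and the inclusion.\<close>

lemma mdiff2_H: "mdiff2 M H"
  by (rule mdiff2_cong[OF mdiff2_add[OF mdiff2_scaleR[OF mdiff2_const mdiff2_comb] mdiff2_ident]])
    (simp add: mean_curv_vec_eq lap_ident)

lemma mdiff2_s: "mdiff2 M s"
  unfolding s_def[abs_def] by (rule mdiff2_inner[OF mdiff2_H mdiff2_H])

lemma lap_H: "p \<in> topspace M \<Longrightarrow> lap M H p = - (real m *\<^sub>R H p) + (real m * s p) *\<^sub>R p"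
  using biharmonic_lap_mean_curv_vec[OF biharm mdiff2_H] by (simp add: s_def)

text \<open>Apply \<open>lap\<close> to \<open>comb_\<nu>\<close> and substitute the biharmonic
  equation in the form \<open>lap_H\<close>.\<close>

lemma comb_\<nu>2:
  assumes p: "p \<in> topspace M"
  shows "comb (\<lambda>i. \<nu> i ^ 2) p = - (2 * real m ^ 2) *\<^sub>R H p + (real m ^ 2 * (s p + 1)) *\<^sub>R p"
proof -
  have "lap M (comb \<nu>) p = lap M (\<lambda>q. real m *\<^sub>R H q + (- real m) *\<^sub>R q) p"
    by (rule lap_cong[OF mdiff2_comb _ p]) (simp add: comb_\<nu>)
  also have "\<dots> = real m *\<^sub>R lap M H p + (- real m) *\<^sub>R lap M (\<lambda>q. q) p"
    by (simp only: lap_add[OF mdiff2_scaleR[OF mdiff2_const mdiff2_H] mdiff2_scaleR[OF mdiff2_const mdiff2_ident] p]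
        lap_cmult[OF mdiff2_H p] lap_cmult[OF mdiff2_ident p])
  also have "\<dots> = - (2 * real m ^ 2) *\<^sub>R H p + (real m ^ 2 * (s p + 1)) *\<^sub>R p"
  proof -
    have *: "A *\<^sub>R (- (A *\<^sub>R x) + D *\<^sub>R y) + (- A) *\<^sub>R (A *\<^sub>R x - A *\<^sub>R y)
        = (- (2 * A ^ 2)) *\<^sub>R x + (A * D + A * A) *\<^sub>R y" for A D :: real and x y :: 'a
    proof -
      have sq: "- (2 * A ^ 2) = - (A * A) - A * A"
        by (simp add: power2_eq_square)
      show ?thesis
        unfolding sq
        by (simp only: scaleR_add_right scaleR_add_left scaleR_diff_left scaleR_diff_right
            scaleR_minus_left scaleR_minus_right scaleR_scaleR) simp
    qed
    show ?thesis
      unfolding lap_H[OF p] lap_ident[OF p] comb_\<nu>[OF p] * by (simp add: algebra_simps power2_eq_square)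
  qed
  finally show ?thesis
    by (simp add: lap_comb p power2_eq_square)
qed

text \<open>The gradient of \<open>s\<close> on \<open>M\<close>, as an ambient vector.\<close>

definition grad_s :: "'a \<Rightarrow> 'a" where
  "grad_s p = (\<Sum>b\<in>Basis. tderiv M b s p *\<^sub>R tan_ext M b p)"

text \<open>Apply \<open>lap\<close> to \<open>comb_\<nu>2\<close>. The gradient is the cross term
  produced by the product of \<open>s\<close> with the position vector.\<close>

lemma comb_\<nu>3:
  assumes p: "p \<in> topspace M"
  shows "comb (\<lambda>i. \<nu> i ^ 3) p = (real m ^ 3 * (s p + 3)) *\<^sub>R H p
    + (real m ^ 2 * lap M s p - real m ^ 3 * (3 * s p + 1)) *\<^sub>R p + (2 * real m ^ 2) *\<^sub>R grad_s p"
proof -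
  let ?m = "real m"
  have s1: "mdiff2 M (\<lambda>q. ?m ^ 2 * (s q + 1))"
    using mdiff2_scaleR[OF mdiff2_const[of "?m ^ 2"] mdiff2_add[OF mdiff2_s mdiff2_const[of 1]]] by simp
  have lap_s1: "lap M (\<lambda>q. ?m ^ 2 * (s q + 1)) p = ?m ^ 2 * lap M s p"
    using lap_cmult[OF mdiff2_add[OF mdiff2_s mdiff2_const[of 1]] p, of "?m ^ 2"]
    by (simp add: lap_add[OF mdiff2_s mdiff2_const p] lap_const p)
  have d_s1: "tderiv M b (\<lambda>q. ?m ^ 2 * (s q + 1)) p = ?m ^ 2 * tderiv M b s p" for b
    using tderiv_scaleR[OF mdiff_const[of _ "?m ^ 2"] mdiff_add[OF mdiff2D(1)[OF mdiff2_s] mdiff_const[of _ 1]] p]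
    by (simp add: tderiv_add[OF mdiff2D(1)[OF mdiff2_s] mdiff_const p] tderiv_const p)
  have "lap M (comb (\<lambda>i. \<nu> i ^ 2)) p
      = lap M (\<lambda>q. (- (2 * ?m ^ 2)) *\<^sub>R H q + (?m ^ 2 * (s q + 1)) *\<^sub>R q) p"
    by (rule lap_cong[OF mdiff2_comb _ p]) (simp add: comb_\<nu>2)
  also have "\<dots> = (- (2 * ?m ^ 2)) *\<^sub>R lap M H p + ((?m ^ 2 * (s p + 1)) *\<^sub>R lap M (\<lambda>q. q) p
      + 2 *\<^sub>R (\<Sum>b\<in>Basis. (?m ^ 2 * tderiv M b s p) *\<^sub>R tan_ext M b p) + (?m ^ 2 * lap M s p) *\<^sub>R p)"
    by (simp only: lap_add[OF mdiff2_scaleR[OF mdiff2_const mdiff2_H] mdiff2_scaleR[OF s1 mdiff2_ident] p]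
        lap_cmult[OF mdiff2_H p] lap_scaleR[OF s1 mdiff2_ident p] lap_s1 d_s1 tderiv_ident[OF p])
  also have "(\<Sum>b\<in>Basis. (?m ^ 2 * tderiv M b s p) *\<^sub>R tan_ext M b p) = ?m ^ 2 *\<^sub>R grad_s p"
    by (simp add: grad_s_def scaleR_sum_right)
  also have "(- (2 * ?m ^ 2)) *\<^sub>R lap M H p + ((?m ^ 2 * (s p + 1)) *\<^sub>R lap M (\<lambda>q. q) p
      + 2 *\<^sub>R ?m ^ 2 *\<^sub>R grad_s p + (?m ^ 2 * lap M s p) *\<^sub>R p)
      = (?m ^ 3 * (s p + 3)) *\<^sub>R H p
        + (?m ^ 2 * lap M s p - ?m ^ 3 * (3 * s p + 1)) *\<^sub>R p + (2 * ?m ^ 2) *\<^sub>R grad_s p"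
  proof -
    have *: "A *\<^sub>R (- (B *\<^sub>R x) + D *\<^sub>R y) + (E *\<^sub>R (B *\<^sub>R x - B *\<^sub>R y) + G + J *\<^sub>R y)
        = (E * B - A * B) *\<^sub>R x + (J - (E * B - A * D)) *\<^sub>R y + G" for A B D E J :: real and x y G :: 'a
      by (simp add: algebra_simps)
    show ?thesis
      unfolding lap_H[OF p] lap_ident[OF p] comb_\<nu>[OF p] * by (simp add: algebra_simps power2_eq_square power3_eq_cube)
  qed
  finally show ?thesis
    by (simp add: lap_comb p power2_eq_square power3_eq_cube mult.assoc)
qed

lemma grad_s_inner:
  assumes p: "p \<in> topspace M"
  shows "grad_s p \<bullet> p = 0" "grad_s p \<bullet> H p = 0" "grad_s p \<bullet> tan_ext M w p = tderiv M w s p"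
proof -
  show "grad_s p \<bullet> p = 0"
    by (simp add: grad_s_def inner_sum_left tan_ext_inner_self p)
  show "grad_s p \<bullet> H p = 0"
    using mean_curv_vec_normal[OF p] by (simp add: grad_s_def inner_sum_left inner_commute[of "tan_ext M _ p" "H p"])
  note lin = linear_tderiv[OF mdiff2D(1)[OF mdiff2_s] p]
  have "grad_s p \<bullet> tan_ext M w p = (\<Sum>b\<in>Basis. (tan_ext M w p \<bullet> b) * tderiv M b s p)"
    unfolding grad_s_def inner_sum_left inner_scaleR_left
    by (intro sum.cong refl) (simp add: tan_ext_inner tan_ext_in p inner_commute mult.commute)
  also have "\<dots> = tderiv M (\<Sum>b\<in>Basis. (tan_ext M w p \<bullet> b) *\<^sub>R b) s p"
    by (simp add: linear_sum[OF lin] linear_scale[OF lin])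
  also have "\<dots> = tderiv M w s p"
    by (simp only: euclidean_representation tderiv_tan_ext[OF p])
  finally show "grad_s p \<bullet> tan_ext M w p = tderiv M w s p" .
qed

section \<open>Constancy of the squared mean curvature\<close>

lemma tderiv_s_eq_0:
  assumes p: "p \<in> topspace M"
  shows "tderiv M w s p = 0"
proof -
  let ?m = "real m"
  \<comment> \<open>Elementary symmetric functions: the \<open>\<nu> i\<close> are the roots of
    \<open>x ^ 3 - e1 * x ^ 2 + e2 * x - e3\<close>.\<close>
  define e1 where "e1 = \<nu> 0 + \<nu> 1 + \<nu> 2"
  define e2 where "e2 = \<nu> 0 * \<nu> 1 + \<nu> 0 * \<nu> 2 + \<nu> 1 * \<nu> 2"
  define e3 where "e3 = \<nu> 0 * \<nu> 1 * \<nu> 2"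
  define C where "C = e3 *\<^sub>R c"
  have cubic: "\<nu> i ^ 3 = e1 * \<nu> i ^ 2 + ((- e2) * \<nu> i + e3 * 1)" if "i < 3" for i
  proof -
    have "i = 0 \<or> i = 1 \<or> i = 2" using that by auto
    then show ?thesis
      by (elim disjE) (simp_all add: e1_def e2_def e3_def power2_eq_square power3_eq_cube algebra_simps)
  qed
  \<comment> \<open>The constant term of the cubic meets \<open>comb (\<lambda>i. 1)\<close>, which
    is the inclusion minus \<open>c\<close>; this is how the constant vector enters.\<close>
  have C: "C = (- (2 * ?m ^ 2 * e1) - ?m * e2 - ?m ^ 3 * (s q + 3)) *\<^sub>R H q
      + (?m ^ 2 * e1 * (s q + 1) + ?m * e2 + e3 + ?m ^ 3 * (3 * s q + 1) - ?m ^ 2 * lap M s q) *\<^sub>R q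
      - (2 * ?m ^ 2) *\<^sub>R grad_s q" if q: "q \<in> topspace M" for q
  proof -
    have "comb (\<lambda>i. \<nu> i ^ 3) q = e1 *\<^sub>R comb (\<lambda>i. \<nu> i ^ 2) q + ((- e2) *\<^sub>R comb \<nu> q + e3 *\<^sub>R comb (\<lambda>i. 1) q)"
      unfolding comb_cmult comb_add by (rule comb_cong[OF cubic])
    moreover have "comb (\<lambda>i. 1) q = q - c"
      using decomp_comb[OF q] by (simp add: algebra_simps)
    ultimately have "C = e1 *\<^sub>R comb (\<lambda>i. \<nu> i ^ 2) q - e2 *\<^sub>R comb \<nu> q + e3 *\<^sub>R q - comb (\<lambda>i. \<nu> i ^ 3) q"
      by (simp add: C_def scaleR_diff_right)
    then show ?thesis
      unfolding comb_\<nu>[OF q] comb_\<nu>2[OF q] comb_\<nu>3[OF q] by (simp add: algebra_simps)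
  qed
  \<comment> \<open>Position vector, \<open>H\<close> and the gradient are mutually orthogonal, so
    inner products read off the coefficients in \<open>C\<close> one at a time.\<close>
  have C_self: "C \<bullet> q = ?m ^ 2 * e1 * (s q + 1) + ?m * e2 + e3 + ?m ^ 3 * (3 * s q + 1) - ?m ^ 2 * lap M s q"
    if q: "q \<in> topspace M" for q
    by (subst C[OF q]) (simp add: inner_add_left inner_diff_left mean_curv_vec_inner_self q grad_s_inner inner_self)
  have C_H: "C \<bullet> H q = (- (2 * ?m ^ 2 * e1) - ?m * e2 - ?m ^ 3 * (s q + 3)) * s q"
    if q: "q \<in> topspace M" for q
    using mean_curv_vec_inner_self[OF q] inner_commute[of "H q" q]
    by (subst C[OF q]) (simp add: inner_add_left inner_diff_left q grad_s_inner flip: s_def)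
  have C_tan: "C \<bullet> tan_ext M v q = - (2 * ?m ^ 2) * tderiv M v s q" if q: "q \<in> topspace M" for q v
    using tan_ext_inner_self[OF q, of v] inner_commute[of q "tan_ext M v q"]
    by (subst C[OF q]) (simp add: inner_add_left inner_diff_left q grad_s_inner mean_curv_vec_normal)
  have C2: "mdiff2 M (\<lambda>q. C \<bullet> q)"
    by (rule mdiff2_inner[OF mdiff2_const mdiff2_ident])
  have dC: "tderiv M v (\<lambda>q. C \<bullet> q) q = - (2 * ?m ^ 2) * tderiv M v s q" if q: "q \<in> topspace M" for q v
    by (simp add: tderiv_inner mdiff_const mdiff_ident q tderiv_const tderiv_ident C_tan)
  \<comment> \<open>\<open>lap\<close> of the height function \<open>C \<bullet> q\<close> is
    computed through \<open>dC\<close> and through \<open>comb_\<nu>\<close>. Then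
    \<open>C_self\<close> eliminates \<open>lap M s q\<close>, and \<open>C_H\<close> is already
    polynomial in \<open>s\<close>.\<close>
  have quadratic: "(?m + 2) * (C \<bullet> q) = (- (?m ^ 4) * s q + (2 * ?m ^ 2 * e1 + 6 * ?m ^ 3 - 2 * ?m ^ 3 * e1
      - ?m ^ 2 * e2 - 3 * ?m ^ 4)) * s q + (2 * ?m ^ 2 * e1 + 2 * ?m * e2 + 2 * e3 + 2 * ?m ^ 3)"
    if q: "q \<in> topspace M" for q
  proof -
    have "tderiv M b (tderiv M b (\<lambda>q. C \<bullet> q)) q = - (2 * ?m ^ 2) * tderiv M b (tderiv M b s) q" for b
    proof -
      have "tderiv M b (tderiv M b (\<lambda>q. C \<bullet> q)) q = tderiv M b (\<lambda>q. (- (2 * ?m ^ 2)) *\<^sub>R tderiv M b s q) q"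
        by (rule tderiv_cong[OF mdiff2D(2)[OF C2] _ q]) (simp add: dC)
      then show ?thesis
        by (simp only: tderiv_scaleR[OF mdiff_const mdiff2D(2)[OF mdiff2_s] q] tderiv_const[OF q]) simp
    qed
    then have "lap M (\<lambda>q. C \<bullet> q) q = - (2 * ?m ^ 2) * lap M s q"
      by (simp add: lap_def sum_distrib_left)
    moreover have "lap M (\<lambda>q. C \<bullet> q) q = ?m * (C \<bullet> H q) - ?m * (C \<bullet> q)"
      by (simp add: lap_inner[OF mdiff2_const mdiff2_ident q] lap_const tderiv_const q lap_ident comb_\<nu> inner_diff_right)
    ultimately have "?m * (C \<bullet> q) = ?m * (C \<bullet> H q) + 2 * (?m ^ 2 * lap M s q)"
      by simp
    then show ?thesis
      using C_self[OF q] unfolding C_H[OF q] by algebra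
  qed
  let ?h1 = "- (?m ^ 4)"
  define h0 where "h0 = 2 * ?m ^ 2 * e1 + 6 * ?m ^ 3 - 2 * ?m ^ 3 * e1 - ?m ^ 2 * e2 - 3 * ?m ^ 4"
  define h2 where "h2 = 2 * ?m ^ 2 * e1 + 2 * ?m * e2 + 2 * e3 + 2 * ?m ^ 3"
  note ds = mdiff2D[OF mdiff2_s]
  have affine: "mdiff M (\<lambda>q. a * s q + b)" for a b
    using mdiff_add[OF mdiff_bilinear[OF bounded_bilinear_mult mdiff_const[of _ a] ds(1)] mdiff_const[of _ b]] .
  have d_affine: "tderiv M v (\<lambda>q. a * s q + b) q = a * tderiv M v s q" if q: "q \<in> topspace M" for a b v q
    using mdiff_bilinear[OF bounded_bilinear_mult mdiff_const[of M a] ds(1)]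
    by (simp add: tderiv_add mdiff_const q tderiv_const tderiv_bilinear[OF bounded_bilinear_mult mdiff_const ds(1) q])
  \<comment> \<open>The derivative of \<open>quadratic\<close>: by \<open>dC\<close> its left side
    is also a multiple of \<open>tderiv M w s q\<close>, and moving it across produces the summand
    \<open>2 * ?m ^ 2 * (?m + 2)\<close>.\<close>
  have first: "(2 * ?h1 * s q + (h0 + 2 * ?m ^ 2 * (?m + 2))) * tderiv M w s q = 0" if q: "q \<in> topspace M" for q
  proof -
    have m1: "mdiff M (\<lambda>q. (?h1 * s q + h0) * s q)"
      by (rule mdiff_bilinear[OF bounded_bilinear_mult affine ds(1)])
    have "tderiv M w (\<lambda>q. (?m + 2) * (C \<bullet> q)) q = tderiv M w (\<lambda>q. (?h1 * s q + h0) * s q + h2) q"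
    proof (rule tderiv_cong[OF _ _ q])
      show "mdiff M (\<lambda>q. (?m + 2) * (C \<bullet> q))"
        by (rule mdiff_bilinear[OF bounded_bilinear_mult mdiff_const mdiff2D(1)[OF C2]])
      show "(?m + 2) * (C \<bullet> q) = (?h1 * s q + h0) * s q + h2" if "q \<in> topspace M" for q
        using quadratic[OF that] by (simp add: h0_def h2_def)
    qed
    moreover have "tderiv M w (\<lambda>q. (?m + 2) * (C \<bullet> q)) q = (?m + 2) * (- (2 * ?m ^ 2) * tderiv M w s q)"
      by (simp add: tderiv_bilinear[OF bounded_bilinear_mult mdiff_const mdiff2D(1)[OF C2] q] tderiv_const q dC)
    moreover have "tderiv M w (\<lambda>q. (?h1 * s q + h0) * s q + h2) q
        = (?h1 * s q + h0) * tderiv M w s q + ?h1 * tderiv M w s q * s q"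
      by (simp only: tderiv_add[OF m1 mdiff_const q] tderiv_const[OF q] d_affine[OF q] add_0_right
          tderiv_bilinear[OF bounded_bilinear_mult affine ds(1) q])
    ultimately show ?thesis
      by (simp add: algebra_simps)
  qed
  \<comment> \<open>Differentiating the vanishing product once more replaces a case split over the
    points where one or the other factor vanishes.\<close>
  have "tderiv M w (\<lambda>q. (2 * ?h1 * s q + (h0 + 2 * ?m ^ 2 * (?m + 2))) * tderiv M w s q) p = tderiv M w (\<lambda>q. 0) p"
    by (rule tderiv_cong[OF mdiff_bilinear[OF bounded_bilinear_mult affine ds(2)] first p])
  then have "(2 * ?h1 * s p + (h0 + 2 * ?m ^ 2 * (?m + 2))) * tderiv M w (tderiv M w s) p
      + 2 * ?h1 * tderiv M w s p * tderiv M w s p = 0"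
    by (simp only: tderiv_bilinear[OF bounded_bilinear_mult affine ds(2) p] d_affine[OF p] tderiv_const[OF p])
  \<comment> \<open>multiply by \<open>tderiv M w s p\<close>: the second-order term vanishes by \<open>first\<close>\<close>
  then have "2 * ?h1 * tderiv M w s p ^ 3 = 0"
    using first[OF p] by algebra
  then show ?thesis
    using m_pos by simp
qed

text \<open>For constant \<open>s\<close> the inclusion satisfies a quadratic equation in
  \<open>lap\<close> up to a constant, so every eigenvalue is 0 or a root of one quadratic. Three
  distinct eigenvalues must then include 0, and its eigenmap is forced to be constant.\<close>

lemma constant_s_contradiction:
  assumes inj: "inj_on \<nu> {..<3}" and nonconst: "\<And>i. i < 3 \<Longrightarrow> \<not> F i constant_on topspace M"
    and s0: "\<And>p. p \<in> topspace M \<Longrightarrow> s p = s0"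
  shows False
proof -
  let ?m = "real m"
  define \<kappa> where "\<kappa> = ?m ^ 2 * (s0 - 1)"
  define \<alpha> where "\<alpha> i = \<nu> i ^ 2 + 2 * ?m * \<nu> i - \<kappa>" for i
  have perm: "\<exists>j k. {..<3} = {i, j, k} \<and> i \<noteq> j \<and> i \<noteq> k \<and> j \<noteq> k" if "i < 3" for i :: nat
  proof -
    have "{..<3} = {0, 1, 2::nat}" by auto
    moreover have "i = 0 \<or> i = 1 \<or> i = 2" using that by auto
    ultimately show ?thesis
      by (elim disjE) (force intro: exI[of _ 0] exI[of _ 1] exI[of _ 2])+
  qed
  have L0: "comb \<alpha> p = \<kappa> *\<^sub>R c" if p: "p \<in> topspace M" for p
  proof -
    have "comb (\<lambda>i. \<nu> i ^ 2 + (2 * ?m * \<nu> i + (- \<kappa>) * 1)) p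
        = comb (\<lambda>i. \<nu> i ^ 2) p + ((2 * ?m) *\<^sub>R comb \<nu> p + (- \<kappa>) *\<^sub>R comb (\<lambda>i. 1) p)"
      by (simp only: comb_cmult comb_add)
    also have "comb (\<lambda>i. 1) p = p - c"
      using decomp_comb[OF p] by (simp add: algebra_simps)
    finally have "comb \<alpha> p = (- (2 * ?m ^ 2)) *\<^sub>R H p + (?m ^ 2 * (s0 + 1)) *\<^sub>R p
        + ((2 * ?m) *\<^sub>R (?m *\<^sub>R H p - ?m *\<^sub>R p) + (- \<kappa>) *\<^sub>R (p - c))"
      unfolding comb_\<nu>[OF p] comb_\<nu>2[OF p] s0[OF p] by (simp add: \<alpha>_def[abs_def] algebra_simps)
    also have "\<dots> = (- (2 * ?m ^ 2) + 2 * ?m * ?m) *\<^sub>R H p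
        + (?m ^ 2 * (s0 + 1) - 2 * ?m * ?m - \<kappa>) *\<^sub>R p + \<kappa> *\<^sub>R c"
      by (simp only: scaleR_add_left scaleR_diff_left scaleR_diff_right scaleR_minus_left scaleR_scaleR) simp
    also have "\<dots> = \<kappa> *\<^sub>R c"
      by (simp add: \<kappa>_def power2_eq_square algebra_simps)
    finally show ?thesis .
  qed
  \<comment> \<open>\<open>lap\<close> kills constants, so a constant combination yields vanishing
    ones with further factors \<open>\<nu> i\<close>.\<close>
  have step: "comb (\<lambda>i. a i * \<nu> i) p = 0" if "\<And>q. q \<in> topspace M \<Longrightarrow> comb a q = d" "p \<in> topspace M" for a d p
    using lap_cong[OF mdiff2_comb that] by (simp add: lap_comb lap_const that(2))
  have L1: "comb (\<lambda>i. \<alpha> i * \<nu> i) p = 0" if "p \<in> topspace M" for p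
    by (rule step[OF L0 that])
  have L2: "comb (\<lambda>i. \<alpha> i * \<nu> i * \<nu> i) p = 0" if "p \<in> topspace M" for p
    by (rule step[OF L1 that])
  have L3: "comb (\<lambda>i. \<alpha> i * \<nu> i * \<nu> i * \<nu> i) p = 0" if "p \<in> topspace M" for p
    by (rule step[OF L2 that])
  have root: "\<alpha> i * \<nu> i = 0" if i: "i < 3" for i
  proof -
    obtain j k where jk: "{..<3} = {i, j, k}" "i \<noteq> j" "i \<noteq> k" "j \<noteq> k"
      using perm[OF i] by blast
    have ne: "\<nu> i \<noteq> \<nu> j" "\<nu> i \<noteq> \<nu> k"
      using inj jk by (auto simp: inj_on_def)
    obtain p where p: "p \<in> topspace M" "F i p \<noteq> 0"
      using nonconst[OF i] by (auto simp: constant_on_def)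
    \<comment> \<open>The Lagrange factor \<open>(\<nu> l - \<nu> j) * (\<nu> l - \<nu> k)\<close>
      isolates the component \<open>F i\<close>; its expansion needs exactly the powers supplied by
      \<open>L1\<close>, \<open>L2\<close> and \<open>L3\<close>.\<close>
    have "comb (\<lambda>l. \<alpha> l * \<nu> l * \<nu> l * \<nu> l) p + ((- (\<nu> j + \<nu> k)) *\<^sub>R comb (\<lambda>l. \<alpha> l * \<nu> l * \<nu> l) p
        + (\<nu> j * \<nu> k) *\<^sub>R comb (\<lambda>l. \<alpha> l * \<nu> l) p) = 0"
      using L1 L2 L3 p by simp
    then have "comb (\<lambda>l. (\<nu> l - \<nu> j) * (\<nu> l - \<nu> k) * (\<alpha> l * \<nu> l)) p = 0"
      unfolding comb_cmult comb_add by (simp add: algebra_simps)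
    then have "((\<nu> i - \<nu> j) * (\<nu> i - \<nu> k) * (\<alpha> i * \<nu> i)) *\<^sub>R F i p = 0"
      using jk by (simp add: comb_def)
    then show ?thesis
      using ne p(2) by auto
  qed
  show False
  proof (cases "\<exists>i<3. \<nu> i = 0")
    case True
    then obtain i where i: "i < 3" "\<nu> i = 0" by blast
    obtain j k where jk: "{..<3} = {i, j, k}" "i \<noteq> j" "i \<noteq> k" "j \<noteq> k"
      using perm[OF i(1)] by blast
    have "j < 3" "k < 3"
      using jk(1) by auto
    moreover have ne: "\<nu> j \<noteq> 0" "\<nu> k \<noteq> 0" "\<nu> j \<noteq> \<nu> k"
      using inj jk i(2) by (auto simp: inj_on_def)
    ultimately have \<alpha>0: "\<alpha> j = 0" "\<alpha> k = 0"
      using root by fastforce+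
    \<comment> \<open>For \<open>\<kappa> = 0\<close> the quadratic would be
      \<open>x * (x + 2 * ?m)\<close>, forcing both nonzero eigenvalues to equal
      \<open>- 2 * ?m\<close>.\<close>
    have "\<kappa> \<noteq> 0"
    proof
      assume "\<kappa> = 0"
      then have "\<nu> j * (\<nu> j + 2 * ?m) = 0" "\<nu> k * (\<nu> k + 2 * ?m) = 0"
        using \<alpha>0 by (simp_all add: \<alpha>_def power2_eq_square algebra_simps)
      with ne show False by simp
    qed
    \<comment> \<open>The only coefficient of \<open>comb \<alpha>\<close> left is
      \<open>\<alpha> i = - \<kappa>\<close>, so \<open>L0\<close> determines
      \<open>F i\<close>.\<close>
    have "F i p = - c" if "p \<in> topspace M" for p
    proof -
      have "(- \<kappa>) *\<^sub>R F i p = \<kappa> *\<^sub>R c"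
        using L0[OF that] jk \<alpha>0 i(2) by (simp add: comb_def \<alpha>_def[of i])
      then have "\<kappa> *\<^sub>R (F i p + c) = 0"
        by (simp add: scaleR_add_right) (metis add.right_inverse)
      with \<open>\<kappa> \<noteq> 0\<close> show ?thesis
        by (simp add: eq_neg_iff_add_eq_0)
    qed
    then show False
      using nonconst[OF i(1)] by (auto simp: constant_on_def)
  next
    case False
    then have "\<alpha> 0 = 0" "\<alpha> 1 = 0" "\<alpha> 2 = 0"
      using root[of 0] root[of 1] root[of 2] by auto
    moreover have ne: "\<nu> 0 \<noteq> \<nu> 1" "\<nu> 0 \<noteq> \<nu> 2" "\<nu> 1 \<noteq> \<nu> 2"
      using inj_onD[OF inj, of 0 1] inj_onD[OF inj, of 0 2] inj_onD[OF inj, of 1 2] by auto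
    \<comment> \<open>Two distinct roots of the quadratic have sum \<open>- 2 * ?m\<close>, so
      \<open>\<nu> 0\<close> would determine both \<open>\<nu> 1\<close> and
      \<open>\<nu> 2\<close>.\<close>
    moreover have "(\<nu> 0 - \<nu> 1) * (\<nu> 0 + \<nu> 1 + 2 * ?m) = \<alpha> 0 - \<alpha> 1" "(\<nu> 0 - \<nu> 2) * (\<nu> 0 + \<nu> 2 + 2 * ?m) = \<alpha> 0 - \<alpha> 2"
      by (simp_all add: \<alpha>_def algebra_simps power2_eq_square)
    ultimately have "\<nu> 0 + \<nu> 1 + 2 * ?m = 0" "\<nu> 0 + \<nu> 2 + 2 * ?m = 0"
      by simp_all
    then have "\<nu> 1 = \<nu> 2" by simp
    with ne(3) show False by simp
  qed
qed

end

theorem theorem5p10: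
  shows "\<not> (\<exists>M :: 'a::euclidean_space topology.
           submanifold TYPE('m::finite) M \<and> topspace M \<subseteq> topspace unit_sphere \<and>
           PNMC unit_sphere M \<and> biharmonic unit_sphere M \<and> finite_type TYPE('m) 3 M)"
proof
  assume "\<exists>M :: 'a topology. submanifold TYPE('m) M \<and> topspace M \<subseteq> topspace unit_sphere \<and>
    PNMC unit_sphere M \<and> biharmonic unit_sphere M \<and> finite_type TYPE('m) 3 M"
  then obtain M :: "'a topology" where sub: "submanifold TYPE('m) M"
    and sphere: "topspace M \<subseteq> topspace unit_sphere" and bih: "biharmonic unit_sphere M"
    and "finite_type TYPE('m) 3 M"
    by blast
  then obtain c :: 'a and F :: "nat \<Rightarrow> 'a \<Rightarrow> 'a" and \<mu> :: "nat \<Rightarrow> real" where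
    dec: "\<And>p. p \<in> topspace M \<Longrightarrow> p = c + (\<Sum>i<3. F i p)"
    and F: "\<And>i. i < 3 \<Longrightarrow> smooth_map_on TYPE('m) M (F i)" "\<And>i. i < 3 \<Longrightarrow> \<not> F i constant_on topspace M"
      "\<And>i p. i < 3 \<Longrightarrow> p \<in> topspace M \<Longrightarrow> laplacian M (F i) p = \<mu> i *\<^sub>R F i p"
    and inj: "inj_on \<mu> {..<3}"
    unfolding finite_type_def by blast
  \<comment> \<open>The tangential derivative of the inclusion is the projection of
    \<open>w\<close>, so smoothness of the inclusion makes the projection differentiable, as
    \<open>tangent_calculus\<close> demands.\<close>
  have "mdiff M (tderiv M w (\<lambda>q. q))" for w
    by (rule smooth_map_on_mdiff(2)[OF sub smooth_map_on_ident])
  moreover have "tderiv M w (\<lambda>q. q) q = tan_ext M w q" if "q \<in> topspace M" for w q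
    unfolding tderiv_def tan_ext_def
    by (rule dir_deriv_eq[OF has_mderiv_ident orth_proj_in[OF tangent_space_submanifold(1)[OF sub that]]])
  ultimately have "mdiff M (tan_ext M w)" for w
    by (rule mdiff_cong)
  then interpret spherical_calculus M "CARD('m)"
    by unfold_locales (use tangent_space_submanifold[OF sub] sphere in auto)
  have F2: "mdiff2 M (F i)" if "i < 3" for i
    using smooth_map_on_mdiff[OF sub F(1)[OF that]] by (simp add: mdiff2_def)
  interpret biharmonic_three_type M "CARD('m)" c F "\<lambda>i. - \<mu> i"
  proof unfold_locales
    show "lap M (F i) p = - \<mu> i *\<^sub>R F i p" if "i < 3" "p \<in> topspace M" for i p
      using laplacian_eq_lap[OF F2[OF that(1)] that(2)] F(3)[OF that] by (simp add: minus_equation_iff)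
  qed (use bih F2 dec in blast)+
  have "s constant_on topspace M"
    by (rule tderiv_zero_imp_constant[OF sub mdiff2D(1)[OF mdiff2_s] tderiv_s_eq_0])
  then obtain s0 where "\<And>p. p \<in> topspace M \<Longrightarrow> s p = s0"
    by (auto simp: constant_on_def)
  then show False
    by (rule constant_s_contradiction[rotated 2]) (use inj F(2) in \<open>auto simp: inj_on_def\<close>)
qed

end
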